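(* Let $X$ be a compact metric space and let $\varphi:\mathbb{T}^+\times X\to X$ be a dynamical system. (i) For every finite sublattice $\mathsf{A}\subset\mathsf{Att}(\varphi)$ there exists a lattice monomorphism $k:\mathsf{A}\to\mathsf{ANbhd}(\varphi)$ such that $\mathrm{Inv}(k(A))=A$ for all $A\in\mathsf{A}$; that is, $\mathrm{Inv}\circ k=i$, where $i:\mathsf{A}\to\mathsf{Att}(\varphi)$ is the inclusion map. (ii) For every finite sublattice $\mathsf{R}\subset\mathsf{Rep}(\varphi)$ there exists a lattice monomorphism $k:\mathsf{R}\to\mathsf{RNbhd}(\varphi)$ such that $\mathrm{Inv}^+(k(R))=R$ for all $R\in\mathsf{R}$; that is, $\mathrm{Inv}^+\circ k=i$, where $i:\mathsf{R}\to\mathsf{Rep}(\varphi)$ is the inclusion map.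
   Context: $\mathbb{T}$ is $\mathbb{Z}$ or $\mathbb{R}$ and $\mathbb{T}^+=\{t\in\mathbb{T}: t\ge 0\}$; all time intervals are intervals in $\mathbb{T}$. A dynamical system is a continuous map $\varphi:\mathbb{T}^+\times X\to X$ with $\varphi(0,x)=x$ and $\varphi(t,\varphi(s,x))=\varphi(t+s,x)$ for all $s,t\in\mathbb{T}^+$, $x\in X$ (no invertibility in time is assumed). For $S\subset X$: $\varphi(t,S)$ is the image of $S$ if $t\ge0$, and $\varphi(t,S)=\{y\in X:\varphi(-t,y)\in S\}$ if $t<0$. $S$ is invariant if $\varphi(t,S)=S$ for all $t\ge 0$, forward invariant if $\varphi(t,S)\subset S$ for all $t\ge0$, backward invariant if $\varphi(t,S)\subset S$ for all $t\le0$. $\mathrm{Inv}(U)$ (resp. $\mathrm{Inv}^+(U)$) is the union of all invariant (resp. forward invariant) sets contained in $U$. For $U\subset X$, $\omega(U)=\bigcap_{t\ge0}\mathrm{cl}(\varphi([t,\infty),U))$ and $\alpha(U)=\bigcap_{t\le0}\mathrm{cl}(\varphi((-\infty,t],U))$, where $\varphi(I,U)=\bigcup_{t\in I}\varphi(t,U)$. A trapping region is a forward invariant $U\subset X$ with $\varphi(\tau,\mathrm{cl}(U))\subset\mathrm{int}(U)$ for some $\tau>0$; an attractor is a set of the form $\mathrm{Inv}(U)$ with $U$ a trapping region. A repelling region is a backward invariant $U\subset X$ with $\varphi(\tau,\mathrm{cl}(U))\subset\mathrm{int}(U)$ for some $\tau<0$; a repeller is a set of the form $\mathrm{Inv}^+(U)$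 with $U$ a repelling region. $\mathsf{Att}(\varphi)$ and $\mathsf{Rep}(\varphi)$ are the sets of attractors and repellers. $\mathsf{ANbhd}(\varphi)$ is the set of attracting neighborhoods, i.e. subsets $U\subset X$ with $\omega(U)\subset\mathrm{int}(U)$; $\mathsf{RNbhd}(\varphi)$ is the set of repelling neighborhoods, i.e. subsets $U\subset X$ with $\alpha(U)\subset\mathrm{int}(U)$. These are bounded distributive lattices: $\mathsf{ANbhd}(\varphi)$ and $\mathsf{RNbhd}(\varphi)$ with $\vee=\cup$, $\wedge=\cap$, $0=\varnothing$, $1=X$; $\mathsf{Att}(\varphi)$ with $A\vee A'=A\cup A'$, $A\wedge A'=\mathrm{Inv}(A\cap A')$, $0=\varnothing$, $1=\mathrm{Inv}(X)$; $\mathsf{Rep}(\varphi)$ with $\vee=\cup$, $\wedge=\cap$, $0=\varnothing$, $1=X$. For bounded lattices, sublattices are required to contain $0$ and $1$, and lattice homomorphisms are required to preserve $0$ and $1$. A lattice monomorphism is an injective lattice homomorphism. *)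

theory Defs
  imports "HOL-Analysis.Analysis"
begin

text \<open>
  The time domain \<open>T\<close> is a subset of the reals, either \<open>\<int>\<close> or the whole line; the subspace
  topology of \<open>\<int>\<close> is discrete, so the discrete and the continuous case are treated uniformly.
  The phase space is the carrier of an abstract topology \<open>X\<close>, so closures and interiors are
  relative to it. Only the values \<open>\<phi> t x\<close> with \<open>t \<in> nonneg_time T\<close> and
  \<open>x \<in> topspace X\<close> are relevant.
\<close>

definition nonneg_time :: "real set \<Rightarrow> real set" where
  "nonneg_time T = {t \<in> T. 0 \<le> t}"

definition dynamical_system ::
    "real set \<Rightarrow> 'a topology \<Rightarrow> (real \<Rightarrow> 'a \<Rightarrow> 'a) \<Rightarrow> bool" where
  "dynamical_system T X \<phi> \<longleftrightarrow>
     continuous_map (prod_topology (top_of_set (nonneg_time T)) X) X (\<lambda>(t, x). \<phi> t x) \<and>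
     (\<forall>x \<in> topspace X. \<phi> 0 x = x) \<and>
     (\<forall>s \<in> nonneg_time T. \<forall>t \<in> nonneg_time T. \<forall>x \<in> topspace X.
        \<phi> t (\<phi> s x) = \<phi> (t + s) x)"

definition flow_set ::
    "'a topology \<Rightarrow> (real \<Rightarrow> 'a \<Rightarrow> 'a) \<Rightarrow> real \<Rightarrow> 'a set \<Rightarrow> 'a set" where
  "flow_set X \<phi> t S =
     (if 0 \<le> t then \<phi> t ` S else {y \<in> topspace X. \<phi> (- t) y \<in> S})"

definition flow_image ::
    "'a topology \<Rightarrow> (real \<Rightarrow> 'a \<Rightarrow> 'a) \<Rightarrow> real set \<Rightarrow> 'a set \<Rightarrow> 'a set" where
  "flow_image X \<phi> I U = (\<Union>t \<in> I. flow_set X \<phi> t U)"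

definition invariant_set ::
    "real set \<Rightarrow> 'a topology \<Rightarrow> (real \<Rightarrow> 'a \<Rightarrow> 'a) \<Rightarrow> 'a set \<Rightarrow> bool" where
  "invariant_set T X \<phi> S \<longleftrightarrow>
     S \<subseteq> topspace X \<and> (\<forall>t \<in> T. 0 \<le> t \<longrightarrow> flow_set X \<phi> t S = S)"

definition forward_invariant ::
    "real set \<Rightarrow> 'a topology \<Rightarrow> (real \<Rightarrow> 'a \<Rightarrow> 'a) \<Rightarrow> 'a set \<Rightarrow> bool" where
  "forward_invariant T X \<phi> S \<longleftrightarrow>
     S \<subseteq> topspace X \<and> (\<forall>t \<in> T. 0 \<le> t \<longrightarrow> flow_set X \<phi> t S \<subseteq> S)"

definition backward_invariant ::
    "real set \<Rightarrow> 'a topology \<Rightarrow> (real \<Rightarrow> 'a \<Rightarrow> 'a) \<Rightarrow> 'a set \<Rightarrow> bool" where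
  "backward_invariant T X \<phi> S \<longleftrightarrow>
     S \<subseteq> topspace X \<and> (\<forall>t \<in> T. t \<le> 0 \<longrightarrow> flow_set X \<phi> t S \<subseteq> S)"

definition Inv ::
    "real set \<Rightarrow> 'a topology \<Rightarrow> (real \<Rightarrow> 'a \<Rightarrow> 'a) \<Rightarrow> 'a set \<Rightarrow> 'a set" where
  "Inv T X \<phi> U = \<Union>{S. S \<subseteq> U \<and> invariant_set T X \<phi> S}"

definition Inv_plus ::
    "real set \<Rightarrow> 'a topology \<Rightarrow> (real \<Rightarrow> 'a \<Rightarrow> 'a) \<Rightarrow> 'a set \<Rightarrow> 'a set" where
  "Inv_plus T X \<phi> U = \<Union>{S. S \<subseteq> U \<and> forward_invariant T X \<phi> S}"

definition omega_limit ::
    "real set \<Rightarrow> 'a topology \<Rightarrow> (real \<Rightarrow> 'a \<Rightarrow> 'a) \<Rightarrow> 'a set \<Rightarrow> 'a set" where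
  "omega_limit T X \<phi> U =
     (\<Inter>t \<in> {t \<in> T. 0 \<le> t}. X closure_of (flow_image X \<phi> {s \<in> T. t \<le> s} U))"

definition alpha_limit ::
    "real set \<Rightarrow> 'a topology \<Rightarrow> (real \<Rightarrow> 'a \<Rightarrow> 'a) \<Rightarrow> 'a set \<Rightarrow> 'a set" where
  "alpha_limit T X \<phi> U =
     (\<Inter>t \<in> {t \<in> T. t \<le> 0}. X closure_of (flow_image X \<phi> {s \<in> T. s \<le> t} U))"

definition trapping_region ::
    "real set \<Rightarrow> 'a topology \<Rightarrow> (real \<Rightarrow> 'a \<Rightarrow> 'a) \<Rightarrow> 'a set \<Rightarrow> bool" where
  "trapping_region T X \<phi> U \<longleftrightarrow>
     forward_invariant T X \<phi> U \<and>
     (\<exists>\<tau> \<in> T. 0 < \<tau> \<and> flow_set X \<phi> \<tau> (X closure_of U) \<subseteq> X interior_of U)"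

definition repelling_region ::
    "real set \<Rightarrow> 'a topology \<Rightarrow> (real \<Rightarrow> 'a \<Rightarrow> 'a) \<Rightarrow> 'a set \<Rightarrow> bool" where
  "repelling_region T X \<phi> U \<longleftrightarrow>
     backward_invariant T X \<phi> U \<and>
     (\<exists>\<tau> \<in> T. \<tau> < 0 \<and> flow_set X \<phi> \<tau> (X closure_of U) \<subseteq> X interior_of U)"

definition attractors ::
    "real set \<Rightarrow> 'a topology \<Rightarrow> (real \<Rightarrow> 'a \<Rightarrow> 'a) \<Rightarrow> 'a set set" where
  "attractors T X \<phi> = {Inv T X \<phi> U |U. trapping_region T X \<phi> U}"

definition repellers ::
    "real set \<Rightarrow> 'a topology \<Rightarrow> (real \<Rightarrow> 'a \<Rightarrow> 'a) \<Rightarrow> 'a set set" where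
  "repellers T X \<phi> = {Inv_plus T X \<phi> U |U. repelling_region T X \<phi> U}"

definition attracting_nbhds ::
    "real set \<Rightarrow> 'a topology \<Rightarrow> (real \<Rightarrow> 'a \<Rightarrow> 'a) \<Rightarrow> 'a set set" where
  "attracting_nbhds T X \<phi> =
     {U. U \<subseteq> topspace X \<and> omega_limit T X \<phi> U \<subseteq> X interior_of U}"

definition repelling_nbhds ::
    "real set \<Rightarrow> 'a topology \<Rightarrow> (real \<Rightarrow> 'a \<Rightarrow> 'a) \<Rightarrow> 'a set set" where
  "repelling_nbhds T X \<phi> =
     {U. U \<subseteq> topspace X \<and> alpha_limit T X \<phi> U \<subseteq> X interior_of U}"

text \<open>
  Bounded lattices are given by their operations, because the meet of \<open>Att\<close> is not the
  intersection. The record carries no axioms.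
\<close>

record 'b bounded_lattice_ops =
  lat_carrier :: "'b set"
  lat_join :: "'b \<Rightarrow> 'b \<Rightarrow> 'b"
  lat_meet :: "'b \<Rightarrow> 'b \<Rightarrow> 'b"
  lat_zero :: 'b
  lat_one :: 'b

definition bounded_sublattice :: "'b set \<Rightarrow> 'b bounded_lattice_ops \<Rightarrow> bool" where
  "bounded_sublattice K L \<longleftrightarrow>
     K \<subseteq> lat_carrier L \<and> lat_zero L \<in> K \<and> lat_one L \<in> K \<and>
     (\<forall>a \<in> K. \<forall>b \<in> K. lat_join L a b \<in> K \<and> lat_meet L a b \<in> K)"

definition lattice_hom ::
    "'b bounded_lattice_ops \<Rightarrow> 'c bounded_lattice_ops \<Rightarrow> ('b \<Rightarrow> 'c) \<Rightarrow> bool" where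
  "lattice_hom L M k \<longleftrightarrow>
     k ` lat_carrier L \<subseteq> lat_carrier M \<and>
     k (lat_zero L) = lat_zero M \<and> k (lat_one L) = lat_one M \<and>
     (\<forall>a \<in> lat_carrier L. \<forall>b \<in> lat_carrier L.
        k (lat_join L a b) = lat_join M (k a) (k b) \<and>
        k (lat_meet L a b) = lat_meet M (k a) (k b))"

definition lattice_mono ::
    "'b bounded_lattice_ops \<Rightarrow> 'c bounded_lattice_ops \<Rightarrow> ('b \<Rightarrow> 'c) \<Rightarrow> bool" where
  "lattice_mono L M k \<longleftrightarrow> lattice_hom L M k \<and> inj_on k (lat_carrier L)"

definition Att ::
    "real set \<Rightarrow> 'a topology \<Rightarrow> (real \<Rightarrow> 'a \<Rightarrow> 'a) \<Rightarrow> 'a set bounded_lattice_ops" where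
  "Att T X \<phi> = \<lparr>lat_carrier = attractors T X \<phi>, lat_join = (\<union>),
     lat_meet = (\<lambda>A B. Inv T X \<phi> (A \<inter> B)), lat_zero = {}, lat_one = Inv T X \<phi> (topspace X)\<rparr>"

definition Rep ::
    "real set \<Rightarrow> 'a topology \<Rightarrow> (real \<Rightarrow> 'a \<Rightarrow> 'a) \<Rightarrow> 'a set bounded_lattice_ops" where
  "Rep T X \<phi> = \<lparr>lat_carrier = repellers T X \<phi>, lat_join = (\<union>),
     lat_meet = (\<inter>), lat_zero = {}, lat_one = topspace X\<rparr>"

definition ANbhd ::
    "real set \<Rightarrow> 'a topology \<Rightarrow> (real \<Rightarrow> 'a \<Rightarrow> 'a) \<Rightarrow> 'a set bounded_lattice_ops" where
  "ANbhd T X \<phi> = \<lparr>lat_carrier = attracting_nbhds T X \<phi>, lat_join = (\<union>),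
     lat_meet = (\<inter>), lat_zero = {}, lat_one = topspace X\<rparr>"

definition RNbhd ::
    "real set \<Rightarrow> 'a topology \<Rightarrow> (real \<Rightarrow> 'a \<Rightarrow> 'a) \<Rightarrow> 'a set bounded_lattice_ops" where
  "RNbhd T X \<phi> = \<lparr>lat_carrier = repelling_nbhds T X \<phi>, lat_join = (\<union>),
     lat_meet = (\<inter>), lat_zero = {}, lat_one = topspace X\<rparr>"

end

theory Submission
  imports Defs
begin

text \<open>
  Repellers are closed, the meet of \<open>Rep\<close> is the intersection, and a repeller has arbitrarily small
  repelling neighbourhoods, namely preimages \<open>\<phi>(-t, U)\<close> of a repelling region. For a finite lattice of
  repellers, let \<open>P\<close> be the set of its join-irreducible members. Going upwards through \<open>P\<close> one chooses
  neighbourhoods \<open>N p\<close> so small that \<open>N p \<inter> N q\<close> is covered by the \<open>N r\<close> with \<open>r \<subseteq> p \<inter> q\<close>; then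
  \<open>k R = \<Union>{N p. p \<in> P, p \<subseteq> R}\<close> is a lattice homomorphism.

  For attractors the meet is not the intersection, so the same construction fails. Instead one passes to
  the dual repeller, the set of points whose omega-limit set is not contained in \<open>A\<close>. This is an
  order-reversing map into the repellers that exchanges joins and meets, and the complement of the
  neighbourhood constructed for the dual repeller is an attracting neighbourhood of \<open>A\<close>.
\<close>

section \<open>Neighbourhoods of finitely many closed sets with controlled overlaps\<close>

text \<open>
  The set \<open>Q\<close> of those \<open>p\<close> for which \<open>N p\<close> is already chosen is enlarged by a minimal element of \<open>P - Q\<close>.
  The third clause of the invariant \<open>I\<close> keeps room for the neighbourhoods that are still to be chosen.
\<close>

lemma separated_neighbourhood_choice:
  fixes X :: "'a topology" and P :: "'a set set" and G :: "'a set \<Rightarrow> 'a set \<Rightarrow> bool"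
  assumes fin: "finite P"
    and closed: "\<And>p. p \<in> P \<Longrightarrow> closedin X p"
    and nbhd: "\<And>p N. G p N \<Longrightarrow> p \<subseteq> X interior_of N"
    and sub: "\<And>p N. G p N \<Longrightarrow> N \<subseteq> topspace X"
    and shrink: "\<And>p W. p \<in> P \<Longrightarrow> openin X W \<Longrightarrow> p \<subseteq> W \<Longrightarrow> \<exists>N. G p N \<and> X closure_of N \<subseteq> W"
    and cover: "\<And>p q. p \<in> P \<Longrightarrow> q \<in> P \<Longrightarrow> p \<inter> q \<subseteq> \<Union>{r \<in> P. r \<subseteq> p \<inter> q}"
  shows "\<exists>N. (\<forall>p \<in> P. G p (N p)) \<and>
             (\<forall>p \<in> P. \<forall>q \<in> P. N p \<inter> N q \<subseteq> \<Union>(N ` {r \<in> P. r \<subseteq> p \<inter> q}))"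
proof -
  define V where "V N Z = \<Union>(N ` {r \<in> P. r \<subseteq> Z})" for N :: "'a set \<Rightarrow> 'a set" and Z
  define I where "I Q N \<longleftrightarrow> (\<forall>p \<in> Q. G p (N p)) \<and>
      (\<forall>p \<in> Q. \<forall>q \<in> Q. N p \<inter> N q \<subseteq> V N (p \<inter> q)) \<and>
      (\<forall>p \<in> Q. \<forall>q \<in> P - Q. \<not> p \<subseteq> q \<longrightarrow> X closure_of (N p) \<inter> q \<subseteq> X interior_of (V N (p \<inter> q)))"
    for Q N
  \<comment> \<open>\<open>Q\<close> is kept down-closed so that a new \<open>m\<close> is contained
    in no member of \<open>Q\<close>; then \<open>V N (p \<inter> q)\<close> with \<open>p\<close>
    in \<open>Q\<close> does not change when a neighbourhood of \<open>m\<close> is chosen.\<close>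
  define \<Q> where "\<Q> = {Q. Q \<subseteq> P \<and> (\<forall>q \<in> Q. \<forall>p \<in> P. p \<subseteq> q \<longrightarrow> p \<in> Q) \<and> (\<exists>N. I Q N)}"
  have "finite \<Q>"
    by (rule finite_subset[of _ "Pow P"]) (auto simp: \<Q>_def fin)
  moreover have "{} \<in> \<Q>"
    by (auto simp: \<Q>_def I_def)
  ultimately obtain Q where Q: "Q \<in> \<Q>" and Qmax: "\<And>Q'. Q' \<in> \<Q> \<Longrightarrow> Q \<subseteq> Q' \<Longrightarrow> Q = Q'"
    using finite_has_maximal[of \<Q>] by blast
  obtain N where N: "I Q N" and QP: "Q \<subseteq> P" and down: "\<And>p q. q \<in> Q \<Longrightarrow> p \<in> P \<Longrightarrow> p \<subseteq> q \<Longrightarrow> p \<in> Q"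
    using Q by (auto simp: \<Q>_def)
  have "Q = P"
  proof (rule ccontr)
    assume "Q \<noteq> P"
    then have "finite (P - Q)" "P - Q \<noteq> {}" using fin QP by auto
    then obtain m where m: "m \<in> P" "m \<notin> Q" and mmin: "\<And>r. r \<in> P \<Longrightarrow> r \<notin> Q \<Longrightarrow> r \<subseteq> m \<Longrightarrow> r = m"
      using finite_has_minimal[of "P - Q"] by blast
    \<comment> \<open>A set inside \<open>W1 p\<close> meets \<open>N p\<close> only within
      \<open>V N (p \<inter> m)\<close>. A closure inside \<open>W2 q\<close> is the third clause of
      \<open>I\<close> for \<open>m\<close> and \<open>q\<close>.\<close>
    define W1 where "W1 p = (topspace X - X closure_of (N p)) \<union> X interior_of (V N (p \<inter> m))" for p
    define W2 where "W2 q = (topspace X - q) \<union> X interior_of (V N (m \<inter> q))" for q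
    define W where "W = topspace X \<inter> \<Inter>(W1 ` {p \<in> Q. \<not> p \<subseteq> m}) \<inter>
        \<Inter>(W2 ` {q \<in> P - Q. \<not> m \<subseteq> q})"
    have finQ: "finite Q" using fin QP finite_subset by auto
    have mX: "m \<subseteq> topspace X" using closed[OF m(1)] closedin_subset by auto
    have o1: "openin X (W1 p)" for p
      unfolding W1_def by (intro openin_Un openin_diff) auto
    have o2: "openin X (W2 q)" if "q \<in> P" for q
      unfolding W2_def using closed[OF that] by (intro openin_Un openin_diff) auto
    have "openin X (topspace X \<inter> \<Inter>(W1 ` {p \<in> Q. \<not> p \<subseteq> m} \<union> W2 ` {q \<in> P - Q. \<not> m \<subseteq> q}))"
      using finQ fin o1 o2 by (intro openin_Int_Inter) auto
    then have oW: "openin X W"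
      by (simp add: W_def Inter_Un_distrib Int_assoc)
    have "m \<subseteq> W1 p" if "p \<in> Q" "\<not> p \<subseteq> m" for p
    proof -
      have "X closure_of (N p) \<inter> m \<subseteq> X interior_of (V N (p \<inter> m))"
        using N that m unfolding I_def by blast
      then show ?thesis using mX by (auto simp: W1_def)
    qed
    moreover have "m \<subseteq> W2 q" if q: "q \<in> P - Q" "\<not> m \<subseteq> q" for q
    proof -
      \<comment> \<open>As \<open>m\<close> is not inside \<open>q\<close>, such an \<open>r\<close>
        differs from \<open>m\<close>, so minimality puts it in \<open>Q\<close>, where
        \<open>N r\<close> is already fixed.\<close>
      have "r \<subseteq> X interior_of (V N (m \<inter> q))" if r: "r \<in> P" "r \<subseteq> m \<inter> q" for r
      proof -
        have "r \<in> Q" using mmin[of r] r q by blast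
        then have "r \<subseteq> X interior_of (N r)" using N nbhd by (auto simp: I_def)
        also have "\<dots> \<subseteq> X interior_of (V N (m \<inter> q))"
          using r by (intro interior_of_mono) (auto simp: V_def)
        finally show ?thesis .
      qed
      then have "m \<inter> q \<subseteq> X interior_of (V N (m \<inter> q))"
        using cover[of m q] m q by blast
      then show ?thesis using mX by (auto simp: W2_def)
    qed
    ultimately have "m \<subseteq> W" using mX by (auto simp: W_def)
    then obtain L where L: "G m L" and LW: "X closure_of L \<subseteq> W"
      using shrink[OF m(1) oW] by blast
    have LW': "L \<subseteq> W" using LW closure_of_subset[OF sub[OF L]] by blast
    define N' where "N' = N(m := L)"
    have VN': "V N' (p \<inter> q) = V N (p \<inter> q)" if "\<not> m \<subseteq> p \<inter> q" for p q
      unfolding V_def N'_def using that by (intro arg_cong[where f = Union] image_cong) auto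
    have nm: "\<not> m \<subseteq> p" if "p \<in> Q" for p using down that m by blast
    have NX: "N p \<subseteq> X closure_of (N p)" if "p \<in> Q" for p
      using N that by (auto simp: I_def intro!: closure_of_subset sub)
    have Nm: "N' p \<inter> N' m \<subseteq> V N' (p \<inter> m)" if p: "p \<in> Q" for p
    proof (cases "p \<subseteq> m")
      case True
      \<comment> \<open>Here \<open>N' p\<close> is itself one of the sets in the union
        \<open>V N' (p \<inter> m)\<close>.\<close>
      then have "p \<in> {r \<in> P. r \<subseteq> p \<inter> m}" using p QP by auto
      then show ?thesis by (auto simp: V_def)
    next
      case False
      have "N' p = N p" "N' m = L" using m p by (auto simp: N'_def)
      moreover have "L \<subseteq> W1 p" using LW' False p by (auto simp: W_def)
      ultimately have "N' p \<inter> N' m \<subseteq> V N (p \<inter> m)"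
        using NX[OF p] interior_of_subset[of X "V N (p \<inter> m)"] by (auto simp: W1_def)
      then show ?thesis using VN'[of p m] nm[OF p] by auto
    qed
    have "I (insert m Q) N'"
      unfolding I_def
    proof (intro conjI ballI impI)
      fix p assume "p \<in> insert m Q"
      then show "G p (N' p)" using N L by (auto simp: N'_def I_def)
    next
      fix p q assume p: "p \<in> insert m Q" and q: "q \<in> insert m Q"
      consider "p = m" "q = m" | "p = m" "q \<in> Q" | "p \<in> Q" "q = m" | "p \<in> Q" "q \<in> Q"
        using p q by auto
      then show "N' p \<inter> N' q \<subseteq> V N' (p \<inter> q)"
      proof cases
        case 1
        then show ?thesis using m by (auto simp: V_def)
      next
        case 2
        then show ?thesis using Nm[of q] by (simp add: Int_commute)
      next
        case 3
        then show ?thesis using Nm[of p] by simp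
      next
        case 4
        then have "N p \<inter> N q \<subseteq> V N (p \<inter> q)" using N by (auto simp: I_def)
        moreover have "N' p = N p" "N' q = N q" using 4 m by (auto simp: N'_def)
        ultimately show ?thesis using VN'[of p q] nm[OF 4(1)] by auto
      qed
    next
      fix p q assume p: "p \<in> insert m Q" and q: "q \<in> P - insert m Q" and pq: "\<not> p \<subseteq> q"
      show "X closure_of (N' p) \<inter> q \<subseteq> X interior_of (V N' (p \<inter> q))"
      proof (cases "p = m")
        case True
        then have "X closure_of (N' p) \<subseteq> W2 q"
        proof -
          have "q \<in> {q \<in> P - Q. \<not> m \<subseteq> q}" using q pq True by auto
          then have "W \<subseteq> W2 q" unfolding W_def by blast
          then show ?thesis using LW True by (simp add: N'_def)
        qed
        then have "X closure_of (N' p) \<inter> q \<subseteq> X interior_of (V N (p \<inter> q))"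
          using True by (auto simp: W2_def)
        then show ?thesis using VN'[of p q] pq True by auto
      next
        case False
        then have pQ: "p \<in> Q" using p by auto
        then have "X closure_of (N p) \<inter> q \<subseteq> X interior_of (V N (p \<inter> q))"
          using N q pq by (auto simp: I_def)
        moreover have "N' p = N p" using False by (auto simp: N'_def)
        ultimately show ?thesis using VN'[of p q] nm[OF pQ] by auto
      qed
    qed
    have "insert m Q \<in> \<Q>"
    proof -
      have "p \<in> insert m Q" if "q \<in> insert m Q" "p \<in> P" "p \<subseteq> q" for p q
      proof (cases "q = m")
        case True
        then show ?thesis using mmin[of p] that by auto
      next
        case False
        then show ?thesis using down[of q p] that by auto
      qed
      then show ?thesis unfolding \<Q>_def using m QP \<open>I (insert m Q) N'\<close> by blast
    qed
    then show False using Qmax[of "insert m Q"] m by auto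
  qed
  then show ?thesis using N by (auto simp: I_def V_def)
qed

section \<open>The semiflow and preimages under its time maps\<close>

locale compact_dynamical_system =
  fixes T :: "real set" and X :: "'a topology" and \<phi> :: "real \<Rightarrow> 'a \<Rightarrow> 'a"
  assumes compact: "compact_space X"
    and hausdorff: "Hausdorff_space X"
    and time: "T = \<int> \<or> T = UNIV"
    and dyn: "dynamical_system T X \<phi>"
begin

abbreviation pos_time :: "real set" where
  "pos_time \<equiv> nonneg_time T"

text \<open>For positive \<open>t\<close> this is \<open>flow_set\<close> at time
  \<open>- t\<close>; indexing by non-negative times avoids the case distinction on the
  sign.\<close>

definition preimage :: "real \<Rightarrow> 'a set \<Rightarrow> 'a set" where
  "preimage t S = {x \<in> topspace X. \<phi> t x \<in> S}"

lemma pos_time_nonneg: "t \<in> pos_time \<Longrightarrow> 0 \<le> t"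
  by (auto simp: nonneg_time_def)

lemma pos_time_of_nat [simp]: "real n \<in> pos_time"
  using time by (auto simp: nonneg_time_def)

lemma pos_time_zero [simp]: "0 \<in> pos_time"
  using pos_time_of_nat[of 0] by simp

lemma pos_time_add [simp]: "s \<in> pos_time \<Longrightarrow> t \<in> pos_time \<Longrightarrow> s + t \<in> pos_time"
  using time by (auto simp: nonneg_time_def)

lemma pos_time_diff: "s \<in> pos_time \<Longrightarrow> t \<in> pos_time \<Longrightarrow> s \<le> t \<Longrightarrow> t - s \<in> pos_time"
  using time by (auto simp: nonneg_time_def)

lemma continuous_flow: "t \<in> pos_time \<Longrightarrow> continuous_map X X (\<phi> t)"
proof -
  assume t: "t \<in> pos_time"
  have c: "continuous_map (prod_topology (top_of_set pos_time) X) X (\<lambda>(t, x). \<phi> t x)"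
    using dyn by (auto simp: dynamical_system_def)
  have "continuous_map X (prod_topology (top_of_set pos_time) X) (\<lambda>x. (t, x))"
    using t by (intro continuous_map_pairedI) auto
  from continuous_map_compose[OF this c] show ?thesis by (simp add: o_def)
qed

lemma flow_in_space: "t \<in> pos_time \<Longrightarrow> x \<in> topspace X \<Longrightarrow> \<phi> t x \<in> topspace X"
  using continuous_flow[of t] by (auto simp: continuous_map_def Pi_iff)

lemma flow_zero: "x \<in> topspace X \<Longrightarrow> \<phi> 0 x = x"
  using dyn by (auto simp: dynamical_system_def)

lemma flow_add:
  "s \<in> pos_time \<Longrightarrow> t \<in> pos_time \<Longrightarrow> x \<in> topspace X \<Longrightarrow> \<phi> t (\<phi> s x) = \<phi> (t + s) x"
  using dyn by (auto simp: dynamical_system_def)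

lemma preimage_mono: "A \<subseteq> B \<Longrightarrow> preimage t A \<subseteq> preimage t B"
  by (auto simp: preimage_def)

lemma preimage_Un: "preimage t (A \<union> B) = preimage t A \<union> preimage t B"
  by (auto simp: preimage_def)

lemma preimage_subset: "preimage t A \<subseteq> topspace X"
  by (auto simp: preimage_def)

lemma preimage_preimage:
  "s \<in> pos_time \<Longrightarrow> t \<in> pos_time \<Longrightarrow> preimage s (preimage t A) = preimage (t + s) A"
  by (auto simp: preimage_def flow_add flow_in_space)

lemma closedin_preimage: "t \<in> pos_time \<Longrightarrow> closedin X C \<Longrightarrow> closedin X (preimage t C)"
  unfolding preimage_def by (intro closedin_continuous_map_preimage[OF continuous_flow])

lemma openin_preimage: "t \<in> pos_time \<Longrightarrow> openin X C \<Longrightarrow> openin X (preimage t C)"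
  unfolding preimage_def by (intro openin_continuous_map_preimage[OF continuous_flow])

lemma closure_of_preimage_subset:
  assumes "t \<in> pos_time" "A \<subseteq> topspace X"
  shows "X closure_of (preimage t A) \<subseteq> preimage t (X closure_of A)"
  using assms by (intro closure_of_minimal preimage_mono closure_of_subset closedin_preimage) auto

lemma preimage_interior_of_subset:
  assumes "t \<in> pos_time"
  shows "preimage t (X interior_of A) \<subseteq> X interior_of (preimage t A)"
  using assms by (intro interior_of_maximal preimage_mono interior_of_subset openin_preimage) auto

text \<open>Compact images are closed in a Hausdorff space; this bounds the closure of an image from
  above, where continuity only bounds it from below.\<close>

lemma closedin_flow_image:
  assumes "t \<in> pos_time" "closedin X C"
  shows "closedin X (\<phi> t ` C)"
  using assms compact hausdorff continuous_flow
  by (metis closedin_compact_space compactin_imp_closedin image_compactin)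

section \<open>Repellers and their eventually repelling neighbourhoods\<close>

lemma Inv_plus_eq:
  "Inv_plus T X \<phi> N = {x \<in> topspace X. \<forall>t \<in> pos_time. \<phi> t x \<in> N}" (is "_ = ?C")
proof
  show "Inv_plus T X \<phi> N \<subseteq> ?C"
    by (fastforce simp: Inv_plus_def forward_invariant_def flow_set_def nonneg_time_def)
next
  \<comment> \<open>\<open>?C\<close> is itself one of the sets in the union: time zero puts it
    inside \<open>N\<close>, and the semigroup law makes it forward invariant.\<close>
  have "?C \<subseteq> N"
    using flow_zero pos_time_zero by (metis (no_types, lifting) mem_Collect_eq subsetI)
  moreover have "forward_invariant T X \<phi> ?C"
    unfolding forward_invariant_def
  proof (intro conjI ballI impI)
    fix t assume "t \<in> T" "0 \<le> t"
    then have "t \<in> pos_time" by (simp add: nonneg_time_def)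
    then show "flow_set X \<phi> t ?C \<subseteq> ?C"
      using \<open>0 \<le> t\<close> by (auto simp: flow_set_def flow_in_space flow_add)
  qed auto
  ultimately show "?C \<subseteq> Inv_plus T X \<phi> N"
    by (auto simp: Inv_plus_def)
qed

text \<open>
  Unlike repelling regions, whose times \<open>\<tau>\<close> may be incommensurable, sets with the following property are
  visibly closed under finite unions. The closure on the left makes complements attracting
  neighbourhoods; \<open>\<alpha>(N) \<subseteq> int N\<close> alone does not: for a constant map with value \<open>c\<close>, every \<open>N\<close> with
  \<open>c \<notin> N\<close> has \<open>\<alpha>(N) = {}\<close>, while \<open>\<omega>(X - N) = {c}\<close> need not lie in the interior of \<open>X - N\<close>.
\<close>

definition eventually_repelling :: "'a set \<Rightarrow> bool" where
  "eventually_repelling N \<longleftrightarrow> N \<subseteq> topspace X \<and>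
     (\<exists>n::nat. \<forall>t \<in> pos_time. real n \<le> t \<longrightarrow> preimage t (X closure_of N) \<subseteq> X interior_of N)"

text \<open>The bound \<open>n \<ge> 1\<close> makes the multiples of \<open>n\<close> cofinal in
  time.\<close>

lemma eventually_repellingE:
  assumes "eventually_repelling N"
  obtains n :: nat where "n \<ge> 1"
    and "\<And>t. t \<in> pos_time \<Longrightarrow> real n \<le> t \<Longrightarrow> preimage t (X closure_of N) \<subseteq> X interior_of N"
proof -
  obtain n :: nat where n: "\<forall>t \<in> pos_time. real n \<le> t \<longrightarrow> preimage t (X closure_of N) \<subseteq> X interior_of N"
    using assms by (auto simp: eventually_repelling_def)
  show ?thesis
    by (rule that[of "Suc n"]) (use n in auto)
qed

lemma eventually_repelling_subset: "eventually_repelling N \<Longrightarrow> N \<subseteq> topspace X"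
  by (simp add: eventually_repelling_def)

lemma eventually_repelling_subset_closure: "eventually_repelling N \<Longrightarrow> N \<subseteq> X closure_of N"
  by (simp add: eventually_repelling_def closure_of_subset)

text \<open>At time \<open>n\<close> such a point is still in \<open>N\<close>, so it lies in a
  preimage that is already inside the interior.\<close>

lemma Inv_plus_subset_interior:
  assumes "eventually_repelling N"
  shows "Inv_plus T X \<phi> N \<subseteq> X interior_of N"
proof -
  obtain n :: nat where "preimage (real n) (X closure_of N) \<subseteq> X interior_of N"
    using eventually_repellingE[OF assms] pos_time_of_nat by (metis order_refl)
  then show ?thesis
    using eventually_repelling_subset_closure[OF assms]
    by (force simp: Inv_plus_eq preimage_def)
qed

text \<open>Multiples of \<open>n\<close> are used because the preimages at these times form a
  decreasing sequence of closed sets, to which compactness applies.\<close>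

lemma Inv_plus_eq_Inter:
  assumes N: "eventually_repelling N" and n1: "n \<ge> 1"
    and n: "\<And>t. t \<in> pos_time \<Longrightarrow> real n \<le> t \<Longrightarrow> preimage t (X closure_of N) \<subseteq> X interior_of N"
  shows "Inv_plus T X \<phi> N = (\<Inter>k::nat. preimage (real (k * n)) (X closure_of N))"
proof
  show "Inv_plus T X \<phi> N \<subseteq> (\<Inter>k::nat. preimage (real (k * n)) (X closure_of N))"
    using eventually_repelling_subset_closure[OF N] pos_time_of_nat
    by (auto simp: Inv_plus_eq preimage_def simp del: of_nat_mult)
next
  show "(\<Inter>k::nat. preimage (real (k * n)) (X closure_of N)) \<subseteq> Inv_plus T X \<phi> N"
  proof
    fix x assume x: "x \<in> (\<Inter>k::nat. preimage (real (k * n)) (X closure_of N))"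
    then have xX: "x \<in> topspace X" by (auto simp: preimage_def)
    have "\<phi> t x \<in> N" if t: "t \<in> pos_time" for t
    proof -
      \<comment> \<open>The time \<open>k * n\<close> is then at least \<open>n\<close> later than
        \<open>t\<close>, so lying in the closure at that time forces \<open>\<phi> t x\<close> into
        the interior.\<close>
      obtain k :: nat where k: "t + real n \<le> real k" using real_arch_simple by blast
      have kn: "real k \<le> real (k * n)" using n1 by (simp add: mult_le_cancel_left1)
      have d: "real (k * n) - t \<in> pos_time"
        using t k kn by (intro pos_time_diff pos_time_of_nat) auto
      have "\<phi> (real (k * n) - t) (\<phi> t x) = \<phi> (real (k * n)) x"
        using flow_add[OF t d xX] by simp
      then have "\<phi> t x \<in> preimage (real (k * n) - t) (X closure_of N)"
        using x flow_in_space[OF t xX] by (auto simp: preimage_def simp del: of_nat_mult)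
      also have "\<dots> \<subseteq> X interior_of N" using k kn d by (intro n) auto
      finally show ?thesis using interior_of_subset[of X N] by (rule subsetD[rotated])
    qed
    then show "x \<in> Inv_plus T X \<phi> N" using xX by (simp add: Inv_plus_eq)
  qed
qed

lemma closedin_Inv_plus:
  assumes N: "eventually_repelling N"
  shows "closedin X (Inv_plus T X \<phi> N)"
proof -
  obtain n :: nat where n: "n \<ge> 1"
    "\<And>t. t \<in> pos_time \<Longrightarrow> real n \<le> t \<Longrightarrow> preimage t (X closure_of N) \<subseteq> X interior_of N"
    using eventually_repellingE[OF N] by blast
  show ?thesis
    using Inv_plus_eq_Inter[OF N n]
    by (auto intro!: closedin_Inter closedin_preimage pos_time_of_nat simp del: of_nat_mult)
qed

text \<open>By compactness: the closed sets of \<open>Inv_plus_eq_Inter\<close> decrease to the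
  repeller, so one of them is already inside \<open>W\<close>.\<close>

lemma preimage_subset_openin:
  assumes N: "eventually_repelling N" and W: "openin X W" "Inv_plus T X \<phi> N \<subseteq> W"
  shows "\<exists>t \<in> pos_time. preimage t (X closure_of N) \<subseteq> W"
proof (rule ccontr)
  assume contra: "\<not> ?thesis"
  obtain n :: nat where n: "n \<ge> 1"
    "\<And>t. t \<in> pos_time \<Longrightarrow> real n \<le> t \<Longrightarrow> preimage t (X closure_of N) \<subseteq> X interior_of N"
    using eventually_repellingE[OF N] by blast
  define C where "C k = preimage (real (k * n)) (X closure_of N) - W" for k
  have "closedin X (C k)" for k
    unfolding C_def using W by (intro closedin_diff closedin_preimage pos_time_of_nat) auto
  moreover have "C k \<noteq> {}" for k
    using contra pos_time_of_nat[of "k * n"] by (auto simp: C_def simp del: of_nat_mult)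
  moreover have "decseq C"
  proof (rule decseq_SucI)
    fix k
    have "preimage (real (Suc k * n)) (X closure_of N)
        = preimage (real (k * n)) (preimage (real n) (X closure_of N))"
      using preimage_preimage[OF pos_time_of_nat[of "k * n"] pos_time_of_nat[of n]]
      by (simp add: algebra_simps)
    also have "\<dots> \<subseteq> preimage (real (k * n)) (X closure_of N)"
      using subset_trans[OF n(2)[OF pos_time_of_nat] interior_of_subset_closure_of]
      by (intro preimage_mono) simp
    finally show "C (Suc k) \<subseteq> C k" by (auto simp: C_def)
  qed
  ultimately have "(\<Inter>k. C k) \<noteq> {}"
    by (rule compact_space_imp_nest[OF compact])
  then show False
    using W(2) Inv_plus_eq_Inter[OF N n] by (auto simp: C_def)
qed

text \<open>Preimages at different times commute, so the defining inclusion is inherited. For the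
  equality, \<open>\<phi> (s + (real n + t)) x \<in> N\<close> puts \<open>\<phi> t x\<close> into a
  preimage of \<open>N\<close> at a time beyond the threshold, hence into \<open>N\<close>.\<close>

lemma eventually_repelling_preimage:
  assumes N: "eventually_repelling N" and s: "s \<in> pos_time"
  shows "eventually_repelling (preimage s N)" "Inv_plus T X \<phi> (preimage s N) = Inv_plus T X \<phi> N"
proof -
  obtain n :: nat where n:
    "\<And>t. t \<in> pos_time \<Longrightarrow> real n \<le> t \<Longrightarrow> preimage t (X closure_of N) \<subseteq> X interior_of N"
    using eventually_repellingE[OF N] by blast
  note sub = eventually_repelling_subset[OF N]
  have "preimage t (X closure_of (preimage s N)) \<subseteq> X interior_of (preimage s N)"
    if t: "t \<in> pos_time" "real n \<le> t" for t
  proof -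
    have "preimage t (X closure_of (preimage s N)) \<subseteq> preimage t (preimage s (X closure_of N))"
      by (intro preimage_mono closure_of_preimage_subset s sub)
    also have "\<dots> = preimage s (preimage t (X closure_of N))"
      using s t by (simp add: preimage_preimage add.commute)
    also have "\<dots> \<subseteq> preimage s (X interior_of N)" by (intro preimage_mono n t)
    also have "\<dots> \<subseteq> X interior_of (preimage s N)" by (intro preimage_interior_of_subset s)
    finally show ?thesis .
  qed
  then show "eventually_repelling (preimage s N)"
    using preimage_subset by (auto simp: eventually_repelling_def)
  show "Inv_plus T X \<phi> (preimage s N) = Inv_plus T X \<phi> N"
  proof
    show "Inv_plus T X \<phi> N \<subseteq> Inv_plus T X \<phi> (preimage s N)"
      using s by (auto simp: Inv_plus_eq preimage_def flow_add flow_in_space)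
    show "Inv_plus T X \<phi> (preimage s N) \<subseteq> Inv_plus T X \<phi> N"
    proof
      fix x assume x: "x \<in> Inv_plus T X \<phi> (preimage s N)"
      then have xX: "x \<in> topspace X" by (simp add: Inv_plus_eq)
      have "\<phi> t x \<in> N" if t: "t \<in> pos_time" for t
      proof -
        have tn: "real n + t \<in> pos_time" using t by simp
        then have "\<phi> (s + (real n + t)) x \<in> N"
          using x s by (simp add: Inv_plus_eq preimage_def flow_add xX)
        then have "\<phi> (s + real n) (\<phi> t x) \<in> N"
          using t s by (simp add: flow_add xX add.assoc)
        then have "\<phi> t x \<in> preimage (s + real n) (X closure_of N)"
          using eventually_repelling_subset_closure[OF N] t
          by (auto simp: preimage_def flow_in_space xX)
        also have "\<dots> \<subseteq> X interior_of N"
          using s pos_time_nonneg[OF s] by (intro n) auto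
        finally show ?thesis using interior_of_subset[of X N] by (rule subsetD[rotated])
      qed
      then show "x \<in> Inv_plus T X \<phi> N" using xX by (simp add: Inv_plus_eq)
    qed
  qed
qed

text \<open>A suitable preimage of \<open>N\<close> has its closure inside \<open>W\<close> and
  still the same repeller.\<close>

lemma eventually_repelling_shrink:
  assumes N: "eventually_repelling N" and W: "openin X W" "Inv_plus T X \<phi> N \<subseteq> W"
  shows "\<exists>L. eventually_repelling L \<and> Inv_plus T X \<phi> L = Inv_plus T X \<phi> N \<and> X closure_of L \<subseteq> W"
proof -
  obtain t where t: "t \<in> pos_time" "preimage t (X closure_of N) \<subseteq> W"
    using preimage_subset_openin[OF assms] by blast
  show ?thesis
    using eventually_repelling_preimage[OF N t(1)] t
      closure_of_preimage_subset[OF t(1) eventually_repelling_subset[OF N]] by blast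
qed

lemma eventually_repelling_empty:
  "eventually_repelling {}" "Inv_plus T X \<phi> {} = {}"
  using pos_time_zero
  unfolding eventually_repelling_def preimage_def Inv_plus_eq by (simp, blast)

text \<open>The larger threshold serves the union. An orbit in \<open>N \<union> L\<close> either
  returns to \<open>N\<close> at arbitrarily late times or ends up in \<open>L\<close>, and by
  \<open>stay\<close> it has then been in that one set throughout.\<close>

lemma eventually_repelling_Un:
  assumes N: "eventually_repelling N" and L: "eventually_repelling L"
  shows "eventually_repelling (N \<union> L)"
    "Inv_plus T X \<phi> (N \<union> L) = Inv_plus T X \<phi> N \<union> Inv_plus T X \<phi> L"
proof -
  obtain n :: nat where n:
    "\<And>t. t \<in> pos_time \<Longrightarrow> real n \<le> t \<Longrightarrow> preimage t (X closure_of N) \<subseteq> X interior_of N"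
    using eventually_repellingE[OF N] by blast
  obtain m :: nat where m:
    "\<And>t. t \<in> pos_time \<Longrightarrow> real m \<le> t \<Longrightarrow> preimage t (X closure_of L) \<subseteq> X interior_of L"
    using eventually_repellingE[OF L] by blast
  have "preimage t (X closure_of (N \<union> L)) \<subseteq> X interior_of (N \<union> L)"
    if t: "t \<in> pos_time" "real (max n m) \<le> t" for t
  proof -
    have "preimage t (X closure_of (N \<union> L)) \<subseteq> X interior_of N \<union> X interior_of L"
      using n[OF t(1)] m[OF t(1)] t(2) by (auto simp: preimage_Un closure_of_Un of_nat_max)
    also have "\<dots> \<subseteq> X interior_of (N \<union> L)"
      by (simp add: interior_of_mono)
    finally show ?thesis .
  qed
  then show "eventually_repelling (N \<union> L)"
    using eventually_repelling_subset[OF N] eventually_repelling_subset[OF L]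
    unfolding eventually_repelling_def by blast
  \<comment> \<open>An orbit that visits \<open>K\<close> at arbitrarily late times has never left \<open>K\<close>.\<close>
  have stay: "x \<in> Inv_plus T X \<phi> K"
    if K: "eventually_repelling K" and x: "x \<in> topspace X"
      and rec: "\<And>t. t \<in> pos_time \<Longrightarrow> \<exists>s \<in> pos_time. t \<le> s \<and> \<phi> s x \<in> K" for x K
  proof -
    obtain k :: nat where k:
      "\<And>t. t \<in> pos_time \<Longrightarrow> real k \<le> t \<Longrightarrow> preimage t (X closure_of K) \<subseteq> X interior_of K"
      using eventually_repellingE[OF K] by blast
    have "\<phi> t x \<in> K" if t: "t \<in> pos_time" for t
    proof -
      obtain s where s: "s \<in> pos_time" "real k + t \<le> s" "\<phi> s x \<in> K"
        using rec[of "real k + t"] t by auto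
      have d: "s - t \<in> pos_time" using s t by (intro pos_time_diff) auto
      have "\<phi> (s - t) (\<phi> t x) = \<phi> s x" using flow_add[OF t d x] by simp
      then have "\<phi> t x \<in> preimage (s - t) (X closure_of K)"
        using s(3) eventually_repelling_subset_closure[OF K] flow_in_space[OF t x]
        by (auto simp: preimage_def)
      then show ?thesis
        using k[OF d] s(2) interior_of_subset[of X K] by auto
    qed
    then show ?thesis using x by (simp add: Inv_plus_eq)
  qed
  show "Inv_plus T X \<phi> (N \<union> L) = Inv_plus T X \<phi> N \<union> Inv_plus T X \<phi> L"
  proof
    show "Inv_plus T X \<phi> N \<union> Inv_plus T X \<phi> L \<subseteq> Inv_plus T X \<phi> (N \<union> L)"
      by (auto simp: Inv_plus_eq)
    show "Inv_plus T X \<phi> (N \<union> L) \<subseteq> Inv_plus T X \<phi> N \<union> Inv_plus T X \<phi> L"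
    proof
      fix x assume x: "x \<in> Inv_plus T X \<phi> (N \<union> L)"
      then have xX: "x \<in> topspace X" and NL: "\<And>t. t \<in> pos_time \<Longrightarrow> \<phi> t x \<in> N \<union> L"
        by (auto simp: Inv_plus_eq)
      show "x \<in> Inv_plus T X \<phi> N \<union> Inv_plus T X \<phi> L"
      proof (cases "\<forall>t \<in> pos_time. \<exists>s \<in> pos_time. t \<le> s \<and> \<phi> s x \<in> N")
        case True
        then show ?thesis using stay[OF N xX] by blast
      next
        case False
        then obtain t where t: "t \<in> pos_time" "\<And>s. s \<in> pos_time \<Longrightarrow> t \<le> s \<Longrightarrow> \<phi> s x \<in> L"
          using NL by blast
        have "\<exists>r \<in> pos_time. s \<le> r \<and> \<phi> r x \<in> L" if s: "s \<in> pos_time" for s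
          using t s pos_time_nonneg by (intro bexI[of _ "s + t"]) auto
        then show ?thesis using stay[OF L xX] by blast
      qed
    qed
  qed
qed

lemma eventually_repelling_UN:
  assumes "finite Q" "\<And>p. p \<in> Q \<Longrightarrow> eventually_repelling (N p)"
  shows "eventually_repelling (\<Union>(N ` Q)) \<and>
    Inv_plus T X \<phi> (\<Union>(N ` Q)) = (\<Union>p \<in> Q. Inv_plus T X \<phi> (N p))"
  using assms
  by (induction Q rule: finite_induct)
     (auto simp: eventually_repelling_empty eventually_repelling_Un)

lemma alpha_limit_subset_interior:
  assumes N: "eventually_repelling N"
  shows "alpha_limit T X \<phi> N \<subseteq> X interior_of N"
proof -
  obtain n :: nat where n1: "n \<ge> 1" and n:
    "\<And>t. t \<in> pos_time \<Longrightarrow> real n \<le> t \<Longrightarrow> preimage t (X closure_of N) \<subseteq> X interior_of N"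
    using eventually_repellingE[OF N] by blast
  \<comment> \<open>The bound is twice \<open>n\<close>: one half shows that
    \<open>\<phi> (real n) x\<close> lies in \<open>N\<close>, the other half carries the closure of
    the preimage into the interior.\<close>
  have "flow_image X \<phi> {s \<in> T. s \<le> - (2 * real n)} N \<subseteq> preimage (real n) N"
  proof
    fix x assume "x \<in> flow_image X \<phi> {s \<in> T. s \<le> - (2 * real n)} N"
    then obtain s where s: "s \<in> T" "s \<le> - (2 * real n)" "x \<in> flow_set X \<phi> s N"
      by (auto simp: flow_image_def)
    have neg: "s < 0" using s(2) n1 by linarith
    have s': "- s \<in> pos_time" using s time neg by (auto simp: nonneg_time_def)
    have d: "- s - real n \<in> pos_time" using s s' by (intro pos_time_diff) auto
    have x: "x \<in> topspace X" "\<phi> (- s) x \<in> N" using s neg by (auto simp: flow_set_def)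
    have "\<phi> (- s - real n) (\<phi> (real n) x) = \<phi> (- s) x"
      using flow_add[OF pos_time_of_nat d x(1), of n] by simp
    then have "\<phi> (real n) x \<in> preimage (- s - real n) (X closure_of N)"
      using x eventually_repelling_subset_closure[OF N] flow_in_space[OF pos_time_of_nat x(1)]
      by (auto simp: preimage_def)
    also have "\<dots> \<subseteq> N"
      using n[OF d] s interior_of_subset[of X N] by simp
    finally show "x \<in> preimage (real n) N" using x by (simp add: preimage_def)
  qed
  then have "X closure_of flow_image X \<phi> {s \<in> T. s \<le> - (2 * real n)} N
      \<subseteq> X closure_of preimage (real n) N"
    by (rule closure_of_mono)
  also have "\<dots> \<subseteq> preimage (real n) (X closure_of N)"
    using eventually_repelling_subset[OF N] by (intro closure_of_preimage_subset) auto
  also have "\<dots> \<subseteq> X interior_of N" by (intro n) auto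
  finally show ?thesis
    using time by (auto simp: alpha_limit_def)
qed

text \<open>A time \<open>t \<ge> 2 * \<sigma>\<close> is split into \<open>\<sigma>\<close>,
  \<open>t - 2 * \<sigma>\<close> and \<open>\<sigma>\<close>: one \<open>\<sigma>\<close> leads
  from the closure into \<open>U\<close>, backward invariance of \<open>U\<close> handles the middle
  part, and the other \<open>\<sigma>\<close> leads into the interior.\<close>

lemma repelling_region_eventually_repelling:
  assumes "repelling_region T X \<phi> U"
  shows "eventually_repelling U"
proof -
  obtain \<tau> where \<tau>: "\<tau> \<in> T" "\<tau> < 0" "flow_set X \<phi> \<tau> (X closure_of U) \<subseteq> X interior_of U"
    and bw: "backward_invariant T X \<phi> U"
    using assms by (auto simp: repelling_region_def)
  have U: "U \<subseteq> topspace X" using bw by (simp add: backward_invariant_def)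
  define \<sigma> where "\<sigma> = - \<tau>"
  have \<sigma>: "\<sigma> \<in> pos_time" "preimage \<sigma> (X closure_of U) \<subseteq> X interior_of U"
    using \<tau> time by (auto simp: \<sigma>_def nonneg_time_def flow_set_def preimage_def)
  have bw': "preimage t U \<subseteq> U" if t: "t \<in> pos_time" for t
  proof (cases "t = 0")
    case True
    then show ?thesis using flow_zero by (auto simp: preimage_def)
  next
    case False
    then have "- t \<in> T" "- t < 0" using t time by (auto simp: nonneg_time_def)
    then show ?thesis
      using bw by (force simp: backward_invariant_def flow_set_def preimage_def)
  qed
  obtain n :: nat where n: "2 * \<sigma> \<le> real n" using real_arch_simple by blast
  have "preimage t (X closure_of U) \<subseteq> X interior_of U" if t: "t \<in> pos_time" "real n \<le> t" for t
  proof -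
    have d: "t - (\<sigma> + \<sigma>) \<in> pos_time"
      using t n by (intro pos_time_diff pos_time_add \<sigma>(1)) auto
    have "preimage t (X closure_of U) = preimage \<sigma> (preimage (t - (\<sigma> + \<sigma>)) (preimage \<sigma> (X closure_of U)))"
      using preimage_preimage[OF d \<sigma>(1)] preimage_preimage[OF \<sigma>(1) pos_time_add[OF \<sigma>(1) d]] by simp
    also have "\<dots> \<subseteq> preimage \<sigma> (preimage (t - (\<sigma> + \<sigma>)) U)"
      using subset_trans[OF \<sigma>(2) interior_of_subset] by (intro preimage_mono)
    also have "\<dots> \<subseteq> preimage \<sigma> (X closure_of U)"
      using subset_trans[OF bw'[OF d] closure_of_subset[OF U]] by (intro preimage_mono)
    also have "\<dots> \<subseteq> X interior_of U" by (rule \<sigma>)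
    finally show ?thesis .
  qed
  then show ?thesis using U by (auto simp: eventually_repelling_def)
qed

section \<open>Lifting finite lattices of repellers\<close>

text \<open>The hypothesis \<open>rep\<close> is phrased through \<open>eventually_repelling\<close>
  so that the lemma serves repellers and dual repellers of attractors alike. Joins are preserved
  because the members of \<open>P\<close> are join-prime, meets because the overlaps of the
  \<open>N p\<close> are controlled.\<close>

lemma eventually_repelling_lift:
  assumes fin: "finite \<R>" and zero: "{} \<in> \<R>" and one: "topspace X \<in> \<R>"
    and join: "\<And>R S. R \<in> \<R> \<Longrightarrow> S \<in> \<R> \<Longrightarrow> R \<union> S \<in> \<R>"
    and meet: "\<And>R S. R \<in> \<R> \<Longrightarrow> S \<in> \<R> \<Longrightarrow> R \<inter> S \<in> \<R>"
    and rep: "\<And>R. R \<in> \<R> \<Longrightarrow> \<exists>N. eventually_repelling N \<and> Inv_plus T X \<phi> N = R"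
  shows "\<exists>k. (\<forall>R \<in> \<R>. eventually_repelling (k R) \<and> Inv_plus T X \<phi> (k R) = R) \<and>
             k {} = {} \<and> k (topspace X) = topspace X \<and>
             (\<forall>R \<in> \<R>. \<forall>S \<in> \<R>. k (R \<union> S) = k R \<union> k S \<and> k (R \<inter> S) = k R \<inter> k S)"
proof -
  \<comment> \<open>The least member of \<open>\<R>\<close> containing \<open>x\<close>; these are exactly the join-irreducible members.\<close>
  define J where "J x = \<Inter>{R \<in> \<R>. x \<in> R}" for x
  define P where "P = J ` topspace X"
  have inter: "\<Inter>\<S> \<in> \<R>" if "finite \<S>" "\<S> \<noteq> {}" "\<S> \<subseteq> \<R>" for \<S>
    using that by (induction \<S> rule: finite_ne_induct) (auto intro: meet)
  have J: "J x \<in> \<R>" if "x \<in> topspace X" for x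
    unfolding J_def using fin one that by (intro inter) auto
  have xJ: "x \<in> J x" for x by (auto simp: J_def)
  have J_subset: "J x \<subseteq> R" if "R \<in> \<R>" "x \<in> R" for x R using that by (auto simp: J_def)
  have RX: "R \<subseteq> topspace X" if "R \<in> \<R>" for R
    using rep[OF that] by (auto simp: Inv_plus_eq)
  have P: "P \<subseteq> \<R>" using J by (auto simp: P_def)
  have finP: "finite P" using P fin finite_subset by auto
  have cover: "R = \<Union>{p \<in> P. p \<subseteq> R}" if R: "R \<in> \<R>" for R
  proof
    show "R \<subseteq> \<Union>{p \<in> P. p \<subseteq> R}"
    proof
      fix x assume "x \<in> R"
      then have "J x \<in> {p \<in> P. p \<subseteq> R}" using RX[OF R] J_subset[OF R] by (auto simp: P_def)
      then show "x \<in> \<Union>{p \<in> P. p \<subseteq> R}" using xJ by blast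
    qed
  qed auto
  \<comment> \<open>If \<open>p = J x\<close>, then \<open>p\<close> lies inside whichever of
    \<open>R\<close> and \<open>S\<close> contains \<open>x\<close>.\<close>
  have irred: "p \<subseteq> R \<or> p \<subseteq> S" if p: "p \<in> P" "p \<subseteq> R \<union> S" "R \<in> \<R>" "S \<in> \<R>" for p R S
  proof -
    obtain x where x: "p = J x" using p by (auto simp: P_def)
    then have "x \<in> R \<or> x \<in> S" using p xJ by auto
    then show ?thesis using x J_subset p by auto
  qed
  define G where "G p N \<longleftrightarrow> eventually_repelling N \<and> Inv_plus T X \<phi> N = p" for p N
  have "\<exists>N. (\<forall>p \<in> P. G p (N p)) \<and>
             (\<forall>p \<in> P. \<forall>q \<in> P. N p \<inter> N q \<subseteq> \<Union>(N ` {r \<in> P. r \<subseteq> p \<inter> q}))"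
  proof (rule separated_neighbourhood_choice[of P X G])
    show "finite P" by (rule finP)
    show "closedin X p" if "p \<in> P" for p
      using rep P that closedin_Inv_plus by (metis subsetD)
    show "p \<subseteq> X interior_of N" if "G p N" for p N
      using that Inv_plus_subset_interior by (auto simp: G_def)
    show "N \<subseteq> topspace X" if "G p N" for p N
      using that eventually_repelling_subset by (auto simp: G_def)
    show "\<exists>N. G p N \<and> X closure_of N \<subseteq> W" if p: "p \<in> P" "openin X W" "p \<subseteq> W" for p W
    proof -
      obtain N where "eventually_repelling N" "Inv_plus T X \<phi> N = p"
        using rep[of p] P p(1) by auto
      then show ?thesis
        using eventually_repelling_shrink[of N W] p by (auto simp: G_def)
    qed
    show "p \<inter> q \<subseteq> \<Union>{r \<in> P. r \<subseteq> p \<inter> q}" if "p \<in> P" "q \<in> P" for p q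
    proof -
      have "p \<inter> q \<in> \<R>" using meet P that by blast
      from cover[OF this] show ?thesis by (rule equalityD1)
    qed
  qed
  then obtain N where "\<forall>p \<in> P. G p (N p)"
    and Nmeet: "\<forall>p \<in> P. \<forall>q \<in> P. N p \<inter> N q \<subseteq> \<Union>(N ` {r \<in> P. r \<subseteq> p \<inter> q})"
    by (elim exE conjE)
  then have NG: "eventually_repelling (N p) \<and> Inv_plus T X \<phi> (N p) = p" if "p \<in> P" for p
    using that by (simp add: G_def)
  define k where "k R = \<Union>(N ` {p \<in> P. p \<subseteq> R})" for R
  have kR: "eventually_repelling (k R) \<and> Inv_plus T X \<phi> (k R) = R" if R: "R \<in> \<R>" for R
  proof -
    have "(\<Union>p \<in> {p \<in> P. p \<subseteq> R}. Inv_plus T X \<phi> (N p)) = \<Union>{p \<in> P. p \<subseteq> R}"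
      using NG by auto
    then have "(\<Union>p \<in> {p \<in> P. p \<subseteq> R}. Inv_plus T X \<phi> (N p)) = R"
      using cover[OF R] by argo
    then show ?thesis
      unfolding k_def using eventually_repelling_UN[of "{p \<in> P. p \<subseteq> R}" N] finP NG by simp
  qed
  moreover have "k {} = {}" using xJ by (auto simp: k_def P_def)
  \<comment> \<open>The whole space is the repeller of \<open>k (topspace X)\<close>, hence
    contained in its interior.\<close>
  moreover have "k (topspace X) = topspace X"
    using kR[OF one] Inv_plus_subset_interior[of "k (topspace X)"] interior_of_subset[of X "k (topspace X)"]
      eventually_repelling_subset[of "k (topspace X)"] by auto
  moreover have "k (R \<union> S) = k R \<union> k S" if "R \<in> \<R>" "S \<in> \<R>" for R S
  proof -
    have "{p \<in> P. p \<subseteq> R \<union> S} = {p \<in> P. p \<subseteq> R} \<union> {p \<in> P. p \<subseteq> S}"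
      using irred that by blast
    then show ?thesis by (simp add: k_def image_Un)
  qed
  moreover have "k (R \<inter> S) = k R \<inter> k S" if "R \<in> \<R>" "S \<in> \<R>" for R S
  proof
    show "k (R \<inter> S) \<subseteq> k R \<inter> k S" by (auto simp: k_def)
    show "k R \<inter> k S \<subseteq> k (R \<inter> S)"
    proof
      fix x assume "x \<in> k R \<inter> k S"
      then obtain p q where "p \<in> P" "q \<in> P" "p \<subseteq> R" "q \<subseteq> S" "x \<in> N p \<inter> N q"
        by (auto simp: k_def)
      moreover from this have "N p \<inter> N q \<subseteq> \<Union>(N ` {r \<in> P. r \<subseteq> p \<inter> q})"
        using Nmeet by simp
      moreover have "\<Union>(N ` {r \<in> P. r \<subseteq> p \<inter> q}) \<subseteq> k (R \<inter> S)"
        unfolding k_def using \<open>p \<subseteq> R\<close> \<open>q \<subseteq> S\<close> by (intro Union_mono image_mono) auto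
      ultimately show "x \<in> k (R \<inter> S)" by (meson subsetD)
    qed
  qed
  ultimately show ?thesis by (intro exI[of _ k]) simp
qed

text \<open>\<open>Inv_plus\<close> is a left inverse of the lift, which gives injectivity;
  \<open>alpha_limit_subset_interior\<close> makes its values repelling neighbourhoods.\<close>

theorem repeller_lift:
  assumes fin: "finite \<R>" and sub: "bounded_sublattice \<R> (Rep T X \<phi>)"
  shows "\<exists>k. lattice_mono ((Rep T X \<phi>)\<lparr>lat_carrier := \<R>\<rparr>) (RNbhd T X \<phi>) k \<and>
             (\<forall>R \<in> \<R>. Inv_plus T X \<phi> (k R) = R)"
proof -
  have lat: "{} \<in> \<R>" "topspace X \<in> \<R>" "\<And>R S. R \<in> \<R> \<Longrightarrow> S \<in> \<R> \<Longrightarrow> R \<union> S \<in> \<R>"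
      "\<And>R S. R \<in> \<R> \<Longrightarrow> S \<in> \<R> \<Longrightarrow> R \<inter> S \<in> \<R>" and reps: "\<R> \<subseteq> repellers T X \<phi>"
    using sub by (auto simp: bounded_sublattice_def Rep_def)
  have rep: "\<exists>N. eventually_repelling N \<and> Inv_plus T X \<phi> N = R" if "R \<in> \<R>" for R
  proof -
    have "R \<in> repellers T X \<phi>" using reps that by auto
    then show ?thesis using repelling_region_eventually_repelling by (auto simp: repellers_def)
  qed
  obtain k where k: "\<forall>R \<in> \<R>. eventually_repelling (k R) \<and> Inv_plus T X \<phi> (k R) = R"
      "k {} = {}" "k (topspace X) = topspace X"
      "\<forall>R \<in> \<R>. \<forall>S \<in> \<R>. k (R \<union> S) = k R \<union> k S \<and> k (R \<inter> S) = k R \<inter> k S"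
    using eventually_repelling_lift[OF fin lat rep] by auto
  have "inj_on k \<R>" using k(1) by (intro inj_on_inverseI[where g = "Inv_plus T X \<phi>"]) auto
  moreover have "k R \<in> repelling_nbhds T X \<phi>" if "R \<in> \<R>" for R
    using alpha_limit_subset_interior[of "k R"] eventually_repelling_subset[of "k R"] k(1) that
    by (auto simp: repelling_nbhds_def)
  ultimately have "lattice_mono ((Rep T X \<phi>)\<lparr>lat_carrier := \<R>\<rparr>) (RNbhd T X \<phi>) k"
    using k by (auto simp: lattice_mono_def lattice_hom_def Rep_def RNbhd_def)
  then show ?thesis using k(1) by auto
qed

section \<open>Tails of orbits and omega-limit sets\<close>

text \<open>For \<open>t\<close> in \<open>pos_time\<close> this is the \<open>flow_image\<close>
  over all times from \<open>t\<close> on, with the sign distinction of \<open>flow_set\<close>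
  resolved.\<close>

definition tail :: "real \<Rightarrow> 'a set \<Rightarrow> 'a set" where
  "tail t S = (\<Union>s \<in> {s \<in> pos_time. t \<le> s}. \<phi> s ` S)"

lemma tail_subset: "S \<subseteq> topspace X \<Longrightarrow> tail t S \<subseteq> topspace X"
  by (auto simp: tail_def flow_in_space)

lemma tail_antimono: "s \<le> t \<Longrightarrow> tail t S \<subseteq> tail s S"
  by (fastforce simp: tail_def)

lemma flow_image_tail:
  assumes S: "S \<subseteq> topspace X" and s: "s \<in> pos_time" and t: "t \<in> pos_time"
  shows "\<phi> s ` tail t S = tail (t + s) S"
proof
  show "\<phi> s ` tail t S \<subseteq> tail (t + s) S"
  proof
    fix y assume "y \<in> \<phi> s ` tail t S"
    then obtain r x where r: "r \<in> pos_time" "t \<le> r" "x \<in> S" "y = \<phi> s (\<phi> r x)"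
      by (auto simp: tail_def)
    then have "y = \<phi> (s + r) x" using flow_add[OF r(1) s] S by auto
    then show "y \<in> tail (t + s) S"
      unfolding tail_def using r s by (intro UN_I[of "s + r"]) auto
  qed
  show "tail (t + s) S \<subseteq> \<phi> s ` tail t S"
  proof
    fix y assume "y \<in> tail (t + s) S"
    then obtain r x where r: "r \<in> pos_time" "t + s \<le> r" "x \<in> S" "y = \<phi> r x"
      by (auto simp: tail_def)
    have d: "r - s \<in> pos_time" using r s pos_time_nonneg[OF t] by (intro pos_time_diff) auto
    have "y = \<phi> s (\<phi> (r - s) x)" using flow_add[OF d s, of x] S r by auto
    moreover have "\<phi> (r - s) x \<in> tail t S"
      unfolding tail_def using r d by (intro UN_I[of "r - s"]) auto
    ultimately show "y \<in> \<phi> s ` tail t S" by blast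
  qed
qed

lemma omega_limit_eq: "omega_limit T X \<phi> S = (\<Inter>t \<in> pos_time. X closure_of (tail t S))"
proof -
  have "flow_image X \<phi> {s \<in> T. t \<le> s} S = tail t S" if "t \<in> pos_time" for t
    using that by (auto simp: flow_image_def flow_set_def tail_def nonneg_time_def)
  then show ?thesis by (simp add: omega_limit_def nonneg_time_def)
qed

text \<open>Integer times are cofinal, and the nested compactness arguments run along a
  sequence.\<close>

lemma omega_limit_eq_nat: "omega_limit T X \<phi> S = (\<Inter>n::nat. X closure_of (tail (real n) S))"
proof
  show "omega_limit T X \<phi> S \<subseteq> (\<Inter>n::nat. X closure_of (tail (real n) S))"
    using pos_time_of_nat by (auto simp: omega_limit_eq)
  show "(\<Inter>n::nat. X closure_of (tail (real n) S)) \<subseteq> omega_limit T X \<phi> S"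
    unfolding omega_limit_eq
  proof (rule INT_greatest)
    fix t assume "t \<in> pos_time"
    obtain n :: nat where "t \<le> real n" using real_arch_simple by blast
    then have "X closure_of (tail (real n) S) \<subseteq> X closure_of (tail t S)"
      by (intro closure_of_mono tail_antimono)
    then show "(\<Inter>n::nat. X closure_of (tail (real n) S)) \<subseteq> X closure_of (tail t S)" by blast
  qed
qed

lemma decseq_closure_tail: "decseq (\<lambda>n. X closure_of (tail (real n) S))"
  by (intro decseq_SucI closure_of_mono tail_antimono) auto

text \<open>The closures of the tails decrease to the omega-limit set, so by compactness one of them
  is already inside \<open>W\<close>.\<close>

lemma omega_limit_tail_subset:
  assumes S: "S \<subseteq> topspace X" and W: "openin X W" "omega_limit T X \<phi> S \<subseteq> W"
  shows "\<exists>t \<in> pos_time. tail t S \<subseteq> W"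
proof (rule ccontr)
  assume contra: "\<not> ?thesis"
  define C where "C n = X closure_of (tail (real n) S) - W" for n
  have "closedin X (C n)" for n
    unfolding C_def using W by (intro closedin_diff) auto
  moreover have "C n \<noteq> {}" for n
    using contra pos_time_of_nat[of n] closure_of_subset[OF tail_subset[OF S], of "real n"]
    unfolding C_def by blast
  moreover have "decseq C"
    using decseq_closure_tail[of S] by (fastforce simp: C_def decseq_def)
  ultimately have "(\<Inter>n. C n) \<noteq> {}"
    by (rule compact_space_imp_nest[OF compact])
  then show False
    using W(2) omega_limit_eq_nat[of S] by (auto simp: C_def)
qed

lemma invariant_set_iff:
  "invariant_set T X \<phi> S \<longleftrightarrow> S \<subseteq> topspace X \<and> (\<forall>t \<in> pos_time. \<phi> t ` S = S)"
  by (auto simp: invariant_set_def flow_set_def nonneg_time_def)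

text \<open>Forward invariance is continuity of \<open>\<phi> t\<close>. Since
  \<open>\<phi> t\<close> may fail to be invertible, a preimage of \<open>y\<close> within the limit
  set has to be found by compactness.\<close>

lemma invariant_omega_limit:
  assumes S: "S \<subseteq> topspace X"
  shows "invariant_set T X \<phi> (omega_limit T X \<phi> S)"
  unfolding invariant_set_iff
proof (intro conjI ballI equalityI)
  show "omega_limit T X \<phi> S \<subseteq> topspace X"
    unfolding omega_limit_eq using pos_time_zero closure_of_subset_topspace by fast
next
  fix t assume t: "t \<in> pos_time"
  show "\<phi> t ` omega_limit T X \<phi> S \<subseteq> omega_limit T X \<phi> S"
    unfolding omega_limit_eq
  proof (rule INT_greatest)
    fix s assume s: "s \<in> pos_time"
    have "\<phi> t ` (\<Inter>s \<in> pos_time. X closure_of (tail s S)) \<subseteq> \<phi> t ` (X closure_of (tail s S))"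
      using s by blast
    also have "\<dots> \<subseteq> X closure_of (\<phi> t ` tail s S)"
      using continuous_flow[OF t] by (simp add: continuous_map_image_closure_subset)
    also have "\<dots> \<subseteq> X closure_of (tail s S)"
      using pos_time_nonneg[OF t] flow_image_tail[OF S t s]
      by (simp add: closure_of_mono tail_antimono)
    finally show "\<phi> t ` (\<Inter>s \<in> pos_time. X closure_of (tail s S)) \<subseteq> X closure_of (tail s S)" .
  qed
  show "omega_limit T X \<phi> S \<subseteq> \<phi> t ` omega_limit T X \<phi> S"
  proof
    fix y assume y: "y \<in> omega_limit T X \<phi> S"
    \<comment> \<open>\<open>C n\<close> collects the candidates for that preimage. It is nonempty
      because \<open>\<phi> t\<close> maps the closure of a tail onto a closed set that contains the
      tail starting \<open>t\<close> later.\<close>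
    define C where "C n = X closure_of (tail (real n) S) \<inter> preimage t {y}" for n
    have "y \<in> topspace X"
      using y closure_of_subset_topspace[of X] by (fastforce simp: omega_limit_eq_nat)
    then have "closedin X {y}"
      using hausdorff Hausdorff_imp_t1_space t1_space_closedin_singleton by metis
    then have "closedin X (C n)" for n
      unfolding C_def by (intro closedin_Int closedin_closure_of closedin_preimage t)
    moreover have "C n \<noteq> {}" for n
    proof -
      have "y \<in> X closure_of (tail (real n + t) S)"
        using y t by (auto simp: omega_limit_eq)
      also have "\<dots> \<subseteq> \<phi> t ` (X closure_of (tail (real n) S))"
        unfolding flow_image_tail[OF S t pos_time_of_nat, symmetric]
        by (intro closure_of_minimal image_mono closure_of_subset tail_subset S closedin_flow_image t) auto
      finally show ?thesis
        using closure_of_subset_topspace[of X] by (fastforce simp: C_def preimage_def)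
    qed
    moreover have "decseq C"
      using decseq_closure_tail[of S] by (fastforce simp: C_def decseq_def)
    ultimately have "(\<Inter>n. C n) \<noteq> {}"
      by (rule compact_space_imp_nest[OF compact])
    then obtain z where z: "z \<in> (\<Inter>n. C n)" by auto
    then have "z \<in> omega_limit T X \<phi> S" "\<phi> t z = y"
      by (auto simp: omega_limit_eq_nat C_def preimage_def)
    then show "y \<in> \<phi> t ` omega_limit T X \<phi> S" by auto
  qed
qed

section \<open>Invariant sets and trapping regions\<close>

lemma Inv_subset: "Inv T X \<phi> U \<subseteq> U"
  by (auto simp: Inv_def)

lemma invariant_subset_Inv: "invariant_set T X \<phi> S \<Longrightarrow> S \<subseteq> U \<Longrightarrow> S \<subseteq> Inv T X \<phi> U"
  by (auto simp: Inv_def)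

lemma invariant_Inv: "invariant_set T X \<phi> (Inv T X \<phi> U)"
proof -
  have "\<phi> t ` S = S" if "invariant_set T X \<phi> S" "t \<in> pos_time" for t S
    using that by (simp add: invariant_set_iff)
  then have "\<phi> t ` Inv T X \<phi> U = Inv T X \<phi> U" if "t \<in> pos_time" for t
    using that by (simp add: Inv_def image_Union)
  moreover have "Inv T X \<phi> U \<subseteq> topspace X"
    by (auto simp: Inv_def invariant_set_iff)
  ultimately show ?thesis by (simp add: invariant_set_iff)
qed

text \<open>Complementation exchanges closure with interior and turns an inclusion of images into
  one of preimages, so \<open>\<tau>\<close> is replaced by \<open>- \<tau>\<close>.\<close>

lemma repelling_region_complement:
  assumes "trapping_region T X \<phi> U"
  shows "repelling_region T X \<phi> (topspace X - U)"
proof -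
  obtain \<tau> where \<tau>: "\<tau> \<in> T" "0 < \<tau>" "\<phi> \<tau> ` (X closure_of U) \<subseteq> X interior_of U"
    and fw: "forward_invariant T X \<phi> U"
    using assms by (auto simp: trapping_region_def flow_set_def)
  have U: "U \<subseteq> topspace X" and fw': "\<And>t x. t \<in> pos_time \<Longrightarrow> x \<in> U \<Longrightarrow> \<phi> t x \<in> U"
    using fw by (auto simp: forward_invariant_def flow_set_def nonneg_time_def)
  have "flow_set X \<phi> t (topspace X - U) \<subseteq> topspace X - U" if t: "t \<in> T" "t \<le> 0" for t
  proof (cases "t = 0")
    case True
    then show ?thesis using flow_zero by (auto simp: flow_set_def)
  next
    case False
    then have "- t \<in> pos_time" using t time by (auto simp: nonneg_time_def)
    then show ?thesis using False t fw' by (auto simp: flow_set_def)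
  qed
  then have "backward_invariant T X \<phi> (topspace X - U)"
    by (auto simp: backward_invariant_def)
  moreover have "flow_set X \<phi> (- \<tau>) (X closure_of (topspace X - U)) \<subseteq> X interior_of (topspace X - U)"
    using \<tau> by (auto simp: flow_set_def closure_of_complement interior_of_complement)
  moreover have "- \<tau> \<in> T" using \<tau> time by auto
  ultimately show ?thesis
    unfolding repelling_region_def using \<tau>(2) by (intro conjI bexI[of _ "- \<tau>"]) auto
qed

text \<open>\<open>S\<close> equals its own image at time \<open>\<tau>\<close>, and that image lies
  in the interior.\<close>

lemma invariant_subset_trapping_region:
  assumes U: "trapping_region T X \<phi> U" and S: "invariant_set T X \<phi> S" "S \<subseteq> X closure_of U"
  shows "S \<subseteq> X interior_of U"
proof -
  obtain \<tau> where \<tau>: "\<tau> \<in> T" "0 < \<tau>" "\<phi> \<tau> ` (X closure_of U) \<subseteq> X interior_of U"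
    using U by (auto simp: trapping_region_def flow_set_def)
  then have "S = \<phi> \<tau> ` S" using S by (auto simp: invariant_set_iff nonneg_time_def)
  then show ?thesis using \<tau>(3) S(2) by blast
qed

lemma trapping_region_subset: "trapping_region T X \<phi> U \<Longrightarrow> U \<subseteq> topspace X"
  by (simp add: trapping_region_def forward_invariant_def)

lemma Inv_trapping_subset_interior:
  assumes U: "trapping_region T X \<phi> U"
  shows "Inv T X \<phi> U \<subseteq> X interior_of U"
  using Inv_subset[of U] closure_of_subset[OF trapping_region_subset[OF U]]
  by (intro invariant_subset_trapping_region[OF U invariant_Inv]) auto

text \<open>A limit set inside the interior of \<open>U\<close> forces a tail into it. Conversely,
  an orbit that has entered \<open>U\<close> stays there, so its limit set is an invariant subset of
  the closure of \<open>U\<close>.\<close>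

lemma omega_limit_subset_attractor_iff:
  assumes U: "trapping_region T X \<phi> U" and x: "x \<in> topspace X"
  shows "omega_limit T X \<phi> {x} \<subseteq> Inv T X \<phi> U \<longleftrightarrow> (\<exists>t \<in> pos_time. \<phi> t x \<in> U)"
proof
  assume "omega_limit T X \<phi> {x} \<subseteq> Inv T X \<phi> U"
  then have "omega_limit T X \<phi> {x} \<subseteq> X interior_of U"
    using Inv_trapping_subset_interior[OF U] by blast
  then obtain t where "t \<in> pos_time" "tail t {x} \<subseteq> X interior_of U"
    using omega_limit_tail_subset[of "{x}" "X interior_of U"] x by auto
  then show "\<exists>t \<in> pos_time. \<phi> t x \<in> U"
    using interior_of_subset[of X U] by (fastforce simp: tail_def)
next
  assume "\<exists>t \<in> pos_time. \<phi> t x \<in> U"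
  then obtain t where t: "t \<in> pos_time" "\<phi> t x \<in> U" by blast
  have fw: "\<And>s y. s \<in> pos_time \<Longrightarrow> y \<in> U \<Longrightarrow> \<phi> s y \<in> U"
    using U by (auto simp: trapping_region_def forward_invariant_def flow_set_def nonneg_time_def)
  have "tail t {x} \<subseteq> U"
  proof
    fix y assume "y \<in> tail t {x}"
    then obtain s where s: "s \<in> pos_time" "t \<le> s" "y = \<phi> s x" by (auto simp: tail_def)
    have d: "s - t \<in> pos_time" using s t by (intro pos_time_diff) auto
    then show "y \<in> U" using fw[OF d t(2)] flow_add[OF t(1) d x] s by simp
  qed
  then have "omega_limit T X \<phi> {x} \<subseteq> X closure_of U"
    unfolding omega_limit_eq using t(1) closure_of_mono[of "tail t {x}" U X] by blast
  then have "omega_limit T X \<phi> {x} \<subseteq> X interior_of U"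
    using invariant_omega_limit[of "{x}"] x by (intro invariant_subset_trapping_region[OF U]) auto
  then show "omega_limit T X \<phi> {x} \<subseteq> Inv T X \<phi> U"
    using invariant_omega_limit[of "{x}"] x interior_of_subset[of X U]
    by (intro invariant_subset_Inv) auto
qed

section \<open>The dual repeller of an attractor\<close>

text \<open>The definition refers to \<open>A\<close> alone, so no trapping region has to be chosen;
  \<open>dual_repeller_Inv\<close> gives the description in terms of any trapping region of
  \<open>A\<close>.\<close>

definition dual_repeller :: "'a set \<Rightarrow> 'a set" where
  "dual_repeller A = {x \<in> topspace X. \<not> omega_limit T X \<phi> {x} \<subseteq> A}"

lemma dual_repeller_Inv:
  assumes U: "trapping_region T X \<phi> U"
  shows "dual_repeller (Inv T X \<phi> U) = Inv_plus T X \<phi> (topspace X - U)"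
  unfolding dual_repeller_def Inv_plus_eq
  by (rule Collect_cong) (simp add: omega_limit_subset_attractor_iff[OF U] flow_in_space cong: conj_cong)

text \<open>Omega-limit sets of points are nonempty, since no tail of an orbit fits into the empty
  open set.\<close>

lemma dual_repeller_empty: "dual_repeller {} = topspace X"
proof -
  have "omega_limit T X \<phi> {x} \<noteq> {}" if x: "x \<in> topspace X" for x
  proof
    assume "omega_limit T X \<phi> {x} = {}"
    then obtain t where "t \<in> pos_time" "tail t {x} \<subseteq> {}"
      using omega_limit_tail_subset[of "{x}" "{}"] x by auto
    then show False by (auto simp: tail_def)
  qed
  then show ?thesis by (auto simp: dual_repeller_def)
qed

text \<open>An omega-limit set is invariant, so it lies in \<open>A \<inter> B\<close> exactly when
  it lies in the largest invariant subset of it.\<close>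

lemma dual_repeller_Inv_inter:
  "dual_repeller (Inv T X \<phi> (A \<inter> B)) = dual_repeller A \<union> dual_repeller B"
proof -
  have "omega_limit T X \<phi> {x} \<subseteq> Inv T X \<phi> (A \<inter> B) \<longleftrightarrow> omega_limit T X \<phi> {x} \<subseteq> A \<inter> B"
    if "x \<in> topspace X" for x
    using Inv_subset[of "A \<inter> B"] invariant_subset_Inv[OF invariant_omega_limit[of "{x}"], of "A \<inter> B"] that
    by auto
  then show ?thesis by (auto simp: dual_repeller_def)
qed

lemma dual_repeller_Inv_topspace: "dual_repeller (Inv T X \<phi> (topspace X)) = {}"
proof -
  have "omega_limit T X \<phi> {x} \<subseteq> Inv T X \<phi> (topspace X)" if "x \<in> topspace X" for x
    using invariant_omega_limit[of "{x}"] that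
    by (intro invariant_subset_Inv) (auto simp: invariant_set_iff)
  then show ?thesis by (auto simp: dual_repeller_def)
qed

text \<open>A limit set inside \<open>A \<union> B\<close> might a priori lie in neither attractor.
  But the orbit enters one of the two trapping regions, and this already puts its limit set inside
  the corresponding attractor.\<close>

lemma dual_repeller_Un:
  assumes "A \<in> attractors T X \<phi>" "B \<in> attractors T X \<phi>"
  shows "dual_repeller (A \<union> B) = dual_repeller A \<inter> dual_repeller B"
proof
  show "dual_repeller (A \<union> B) \<subseteq> dual_repeller A \<inter> dual_repeller B"
    by (auto simp: dual_repeller_def)
  obtain U V where U: "trapping_region T X \<phi> U" "A = Inv T X \<phi> U"
    and V: "trapping_region T X \<phi> V" "B = Inv T X \<phi> V"
    using assms by (auto simp: attractors_def)
  show "dual_repeller A \<inter> dual_repeller B \<subseteq> dual_repeller (A \<union> B)"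
  proof
    fix x assume x: "x \<in> dual_repeller A \<inter> dual_repeller B"
    then have xX: "x \<in> topspace X" by (simp add: dual_repeller_def)
    have "\<not> omega_limit T X \<phi> {x} \<subseteq> A \<union> B"
    proof
      assume "omega_limit T X \<phi> {x} \<subseteq> A \<union> B"
      then have "omega_limit T X \<phi> {x} \<subseteq> X interior_of U \<union> X interior_of V"
        using Inv_trapping_subset_interior[OF U(1)] Inv_trapping_subset_interior[OF V(1)] U(2) V(2)
        by auto
      then obtain t where t: "t \<in> pos_time" "tail t {x} \<subseteq> X interior_of U \<union> X interior_of V"
        using omega_limit_tail_subset[of "{x}" "X interior_of U \<union> X interior_of V"] xX
        by (auto simp: openin_Un)
      then have "\<phi> t x \<in> U \<or> \<phi> t x \<in> V"
        using interior_of_subset[of X U] interior_of_subset[of X V] by (auto simp: tail_def)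
      then have "omega_limit T X \<phi> {x} \<subseteq> A \<or> omega_limit T X \<phi> {x} \<subseteq> B"
        using omega_limit_subset_attractor_iff[OF U(1) xX] omega_limit_subset_attractor_iff[OF V(1) xX]
          U(2) V(2) t(1) by auto
      then show False using x by (auto simp: dual_repeller_def)
    qed
    then show "x \<in> dual_repeller (A \<union> B)" using xX by (simp add: dual_repeller_def)
  qed
qed

section \<open>Complements of eventually repelling sets as attracting neighbourhoods\<close>

text \<open>Applied both ways, this shows that the invariant part of the complement depends only on
  the repeller. For suitable \<open>t\<close>, the map \<open>\<phi> t\<close> sends the complement
  of \<open>N\<close> into that of \<open>L\<close>, and an invariant set equals its image.\<close>

lemma Inv_complement_subset:
  assumes N: "eventually_repelling N" and L: "eventually_repelling L"
    and eq: "Inv_plus T X \<phi> N = Inv_plus T X \<phi> L"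
  shows "Inv T X \<phi> (topspace X - N) \<subseteq> Inv T X \<phi> (topspace X - L)"
proof (rule invariant_subset_Inv[OF invariant_Inv])
  let ?S = "Inv T X \<phi> (topspace X - N)"
  obtain t where t: "t \<in> pos_time" "preimage t (X closure_of L) \<subseteq> X interior_of N"
    using preimage_subset_openin[OF L, of "X interior_of N"] Inv_plus_subset_interior[OF N] eq by auto
  have S: "\<phi> t ` ?S = ?S" "?S \<subseteq> topspace X"
    using invariant_Inv[of "topspace X - N"] t by (auto simp: invariant_set_iff)
  have "\<phi> t x \<in> topspace X - L" if x: "x \<in> ?S" for x
  proof -
    have "x \<notin> preimage t (X closure_of L)"
      using x Inv_subset[of "topspace X - N"] t(2) interior_of_subset[of X N] by auto
    then show ?thesis
      using x S(2) eventually_repelling_subset_closure[OF L] flow_in_space[OF t(1)]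
      by (auto simp: preimage_def)
  qed
  then have "\<phi> t ` ?S \<subseteq> topspace X - L" by (rule image_subsetI)
  then show "?S \<subseteq> topspace X - L" by (simp only: S(1))
qed

text \<open>From time \<open>n\<close> on, the closure of \<open>?V\<close> is mapped into the
  interior of \<open>?V\<close>. The tail from \<open>2 * n\<close> on therefore lies in the image
  of that closure at time \<open>n\<close>, which is closed by compactness and contained in the
  interior.\<close>

lemma omega_limit_complement_subset_interior:
  assumes N: "eventually_repelling N"
  shows "omega_limit T X \<phi> (topspace X - N) \<subseteq> X interior_of (topspace X - N)"
proof -
  let ?V = "topspace X - N"
  obtain n :: nat where n:
    "\<And>t. t \<in> pos_time \<Longrightarrow> real n \<le> t \<Longrightarrow> preimage t (X closure_of N) \<subseteq> X interior_of N"
    using eventually_repellingE[OF N] by blast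
  have V: "\<phi> t ` (X closure_of ?V) \<subseteq> X interior_of ?V" if t: "t \<in> pos_time" "real n \<le> t" for t
    using n[OF t] flow_in_space[OF t(1)]
    by (auto simp: closure_of_complement interior_of_complement preimage_def)
  have clV: "?V \<subseteq> X closure_of ?V" by (intro closure_of_subset) auto
  have "tail (real n) ?V \<subseteq> X closure_of ?V"
  proof -
    have "\<phi> t ` ?V \<subseteq> ?V" if t: "t \<in> pos_time" "real n \<le> t" for t
      using V[OF t] clV interior_of_subset[of X ?V] by fast
    then show ?thesis using clV unfolding tail_def by blast
  qed
  then have "tail (real n + real n) ?V \<subseteq> \<phi> (real n) ` (X closure_of ?V)"
    using flow_image_tail[of ?V "real n" "real n"] image_mono by (metis Diff_subset pos_time_of_nat)
  then have "X closure_of (tail (real n + real n) ?V) \<subseteq> \<phi> (real n) ` (X closure_of ?V)"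
    by (intro closure_of_minimal closedin_flow_image) auto
  also have "\<dots> \<subseteq> X interior_of ?V" by (intro V) auto
  finally show ?thesis
    unfolding omega_limit_eq using pos_time_add[OF pos_time_of_nat pos_time_of_nat, of n n] by blast
qed

section \<open>Lifting finite lattices of attractors\<close>

text \<open>\<open>dual_repeller\<close> exchanges joins and meets, and taking complements of the
  lifted neighbourhoods exchanges them back.\<close>

theorem attractor_lift:
  assumes fin: "finite \<A>" and sub: "bounded_sublattice \<A> (Att T X \<phi>)"
  shows "\<exists>k. lattice_mono ((Att T X \<phi>)\<lparr>lat_carrier := \<A>\<rparr>) (ANbhd T X \<phi>) k \<and>
             (\<forall>A \<in> \<A>. Inv T X \<phi> (k A) = A)"
proof -
  have zero: "{} \<in> \<A>" and one: "Inv T X \<phi> (topspace X) \<in> \<A>"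
    and join: "\<And>A B. A \<in> \<A> \<Longrightarrow> B \<in> \<A> \<Longrightarrow> A \<union> B \<in> \<A>"
    and meet: "\<And>A B. A \<in> \<A> \<Longrightarrow> B \<in> \<A> \<Longrightarrow> Inv T X \<phi> (A \<inter> B) \<in> \<A>"
    and att: "\<And>A. A \<in> \<A> \<Longrightarrow> A \<in> attractors T X \<phi>"
    using sub by (auto simp: bounded_sublattice_def Att_def)
  define \<R> where "\<R> = dual_repeller ` \<A>"
  have "finite \<R>" using fin by (simp add: \<R>_def)
  moreover have "{} \<in> \<R>" unfolding \<R>_def using one dual_repeller_Inv_topspace by (metis imageI)
  moreover have "topspace X \<in> \<R>" unfolding \<R>_def using zero dual_repeller_empty by (metis imageI)
  moreover have "R \<union> S \<in> \<R>" if "R \<in> \<R>" "S \<in> \<R>" for R S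
    using that meet by (auto simp: \<R>_def dual_repeller_Inv_inter[symmetric])
  moreover have "R \<inter> S \<in> \<R>" if "R \<in> \<R>" "S \<in> \<R>" for R S
    using that join att by (auto simp: \<R>_def dual_repeller_Un[symmetric])
  moreover have region: "\<exists>U. U \<subseteq> topspace X \<and> A = Inv T X \<phi> U \<and>
      eventually_repelling (topspace X - U) \<and> Inv_plus T X \<phi> (topspace X - U) = dual_repeller A"
    if "A \<in> \<A>" for A
  proof -
    obtain U where U: "trapping_region T X \<phi> U" "A = Inv T X \<phi> U"
      using att[OF \<open>A \<in> \<A>\<close>] by (auto simp: attractors_def)
    show ?thesis
      using U trapping_region_subset[OF U(1)] dual_repeller_Inv[OF U(1)]
        repelling_region_eventually_repelling[OF repelling_region_complement[OF U(1)]] by auto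
  qed
  have "\<exists>N. eventually_repelling N \<and> Inv_plus T X \<phi> N = R" if "R \<in> \<R>" for R
    using that region by (auto simp: \<R>_def)
  ultimately obtain h where h: "\<forall>R \<in> \<R>. eventually_repelling (h R) \<and> Inv_plus T X \<phi> (h R) = R"
      "h {} = {}" "h (topspace X) = topspace X"
      "\<forall>R \<in> \<R>. \<forall>S \<in> \<R>. h (R \<union> S) = h R \<union> h S \<and> h (R \<inter> S) = h R \<inter> h S"
    using eventually_repelling_lift[of \<R>] by auto
  define k where "k A = topspace X - h (dual_repeller A)" for A
  have hA: "eventually_repelling (h (dual_repeller A))"
      "Inv_plus T X \<phi> (h (dual_repeller A)) = dual_repeller A" if "A \<in> \<A>" for A
    using h(1) that by (auto simp: \<R>_def)
  have Inv_k: "Inv T X \<phi> (k A) = A" if A: "A \<in> \<A>" for A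
  proof -
    obtain U where U: "U \<subseteq> topspace X" "A = Inv T X \<phi> U" "eventually_repelling (topspace X - U)"
        "Inv_plus T X \<phi> (topspace X - U) = dual_repeller A"
      using region[OF A] by auto
    \<comment> \<open>\<open>topspace X - U\<close> and \<open>h (dual_repeller A)\<close> are
      eventually repelling with the same repeller, so their complements have the same invariant
      part.\<close>
    have "Inv T X \<phi> (k A) = Inv T X \<phi> (topspace X - (topspace X - U))"
      unfolding k_def using hA[OF A] U by (intro equalityI Inv_complement_subset) auto
    also have "topspace X - (topspace X - U) = U" using U(1) by auto
    finally show ?thesis using U(2) by simp
  qed
  have "inj_on k \<A>" by (rule inj_on_inverseI) (rule Inv_k)
  moreover have "k A \<in> attracting_nbhds T X \<phi>" if "A \<in> \<A>" for A
    using omega_limit_complement_subset_interior[OF hA(1)[OF that]]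
    by (auto simp: k_def attracting_nbhds_def)
  moreover have "k {} = {}" "k (Inv T X \<phi> (topspace X)) = topspace X"
    by (simp_all add: k_def dual_repeller_empty dual_repeller_Inv_topspace h)
  moreover have "k (A \<union> B) = k A \<union> k B" "k (Inv T X \<phi> (A \<inter> B)) = k A \<inter> k B"
    if "A \<in> \<A>" "B \<in> \<A>" for A B
    using h(4) that att by (auto simp: k_def dual_repeller_Un dual_repeller_Inv_inter \<R>_def)
  ultimately have "lattice_mono ((Att T X \<phi>)\<lparr>lat_carrier := \<A>\<rparr>) (ANbhd T X \<phi>) k"
    by (auto simp: lattice_mono_def lattice_hom_def Att_def ANbhd_def)
  then show ?thesis using Inv_k by auto
qed

end

section \<open>Transfer to compact metric spaces\<close>

theorem theorem1p2:
  fixes M :: "'a set" and d :: "'a \<Rightarrow> 'a \<Rightarrow> real"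
    and X :: "'a topology" and T :: "real set" and \<phi> :: "real \<Rightarrow> 'a \<Rightarrow> 'a"
  assumes metric: "Metric_space M d"
    and X: "X = Metric_space.mtopology M d"
    and compact: "compact_space X"
    and time: "T = \<int> \<or> T = UNIV"
    and dyn: "dynamical_system T X \<phi>"
  shows "(\<forall>\<A>. finite \<A> \<and> bounded_sublattice \<A> (Att T X \<phi>) \<longrightarrow>
            (\<exists>k. lattice_mono ((Att T X \<phi>)\<lparr>lat_carrier := \<A>\<rparr>) (ANbhd T X \<phi>) k \<and>
                 (\<forall>A \<in> \<A>. Inv T X \<phi> (k A) = A))) \<and>
         (\<forall>\<R>. finite \<R> \<and> bounded_sublattice \<R> (Rep T X \<phi>) \<longrightarrow>
            (\<exists>k. lattice_mono ((Rep T X \<phi>)\<lparr>lat_carrier := \<R>\<rparr>) (RNbhd T X \<phi>) k \<and>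
                 (\<forall>R \<in> \<R>. Inv_plus T X \<phi> (k R) = R)))"
proof -
  have "Hausdorff_space X" unfolding X by (rule Metric_space.Hausdorff_space_mtopology[OF metric])
  then interpret compact_dynamical_system T X \<phi>
    using compact time dyn by unfold_locales
  show ?thesis
  proof (intro conjI allI impI)
    fix \<A> assume "finite \<A> \<and> bounded_sublattice \<A> (Att T X \<phi>)"
    then show "\<exists>k. lattice_mono ((Att T X \<phi>)\<lparr>lat_carrier := \<A>\<rparr>) (ANbhd T X \<phi>) k \<and>
        (\<forall>A \<in> \<A>. Inv T X \<phi> (k A) = A)"
      by (elim conjE, intro attractor_lift)
  next
    fix \<R> assume "finite \<R> \<and> bounded_sublattice \<R> (Rep T X \<phi>)"
    then show "\<exists>k. lattice_mono ((Rep T X \<phi>)\<lparr>lat_carrier := \<R>\<rparr>) (RNbhd T X \<phi>) k \<and>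
        (\<forall>R \<in> \<R>. Inv_plus T X \<phi> (k R) = R)"
      by (elim conjE, intro repeller_lift)
  qed
qed

end
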